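(* For every weight $w$ on $\mathbb{R}^n$, $$[w]_{A_\infty}\ \approx\ \sup_{b:\ \|b\|_{\mathrm{BMO}}=1}\ \sup_{Q}\ \frac{1}{w(Q)}\int_Q|b(x)-b_Q|\,w(x)\,dx,$$ that is, each side is bounded by a constant depending only on $n$ times the other.
   Context: A weight is a non-negative locally integrable function on $\mathbb{R}^n$; $w(Q)=\int_Q w\,dx$. Cubes have sides parallel to the axes. For $b\in L^1_{loc}(\mathbb{R}^n)$, $b_Q=\frac{1}{|Q|}\int_Q b$ and $\|b\|_{\mathrm{BMO}}=\sup_Q\frac{1}{|Q|}\int_Q|b-b_Q|\,dx$. The Fujii–Wilson constant is $$[w]_{A_\infty}=\sup_Q\frac{1}{w(Q)}\int_Q M(w\chi_Q)\,dx,$$ where $M$ is the Hardy–Littlewood maximal operator $Mg(x)=\sup_{R\ni x}\frac{1}{|R|}\int_R|g|$ (supremum over cubes $R$ containing $x$). Suprema of quotients with denominator $w(Q)$ are taken over cubes $Q$ with $w(Q)>0$. The quantities may equal $+\infty$. *)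

theory Defs
  imports "HOL-Analysis.Analysis"
begin

text \<open>Cubes are closed and nondegenerate, with side length \<open>l\<close>.\<close>

definition cubes :: "(real ^ 'n) set set" where
  "cubes = {Q. \<exists>a l. l > 0 \<and> Q = cbox a (a + (\<chi> i. l))}"

definition locally_integrable :: "(real ^ 'n \<Rightarrow> real) \<Rightarrow> bool" where
  "locally_integrable f \<longleftrightarrow> (\<forall>K. compact K \<longrightarrow> f absolutely_integrable_on K)"

definition is_weight :: "(real ^ 'n \<Rightarrow> real) \<Rightarrow> bool" where
  "is_weight w \<longleftrightarrow> (\<forall>x. 0 \<le> w x) \<and> locally_integrable w"

definition weight_of :: "(real ^ 'n \<Rightarrow> real) \<Rightarrow> (real ^ 'n) set \<Rightarrow> ennreal" where
  "weight_of w Q = (\<integral>\<^sup>+x\<in>Q. ennreal (w x) \<partial>lebesgue)"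

definition average :: "(real ^ 'n \<Rightarrow> real) \<Rightarrow> (real ^ 'n) set \<Rightarrow> real" where
  "average b Q = (LINT x:Q|lebesgue. b x) / measure lebesgue Q"

definition BMO_norm :: "(real ^ 'n \<Rightarrow> real) \<Rightarrow> ennreal" where
  "BMO_norm b =
     (SUP Q\<in>cubes. (\<integral>\<^sup>+x\<in>Q. ennreal \<bar>b x - average b Q\<bar> \<partial>lebesgue) / emeasure lebesgue Q)"

definition maximal :: "(real ^ 'n \<Rightarrow> real) \<Rightarrow> real ^ 'n \<Rightarrow> ennreal" where
  "maximal g x =
     (SUP R\<in>{R\<in>cubes. x \<in> R}. (\<integral>\<^sup>+y\<in>R. ennreal \<bar>g y\<bar> \<partial>lebesgue) / emeasure lebesgue R)"

text \<open>Suprema are taken in \<^typ>\<open>ennreal\<close>: they may be infinite, and the supremum of the empty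
  family (which occurs when \<open>w\<close> vanishes almost everywhere) is 0.\<close>

definition A_infinity :: "(real ^ 'n \<Rightarrow> real) \<Rightarrow> ennreal" where
  "A_infinity w =
     (SUP Q\<in>{Q\<in>cubes. weight_of w Q > 0}.
        (\<integral>\<^sup>+x\<in>Q. maximal (\<lambda>y. w y * indicator Q y) x \<partial>lebesgue) / weight_of w Q)"

definition weighted_oscillation :: "(real ^ 'n \<Rightarrow> real) \<Rightarrow> ennreal" where
  "weighted_oscillation w =
     (SUP b\<in>{b. locally_integrable b \<and> BMO_norm b = 1}.
        SUP Q\<in>{Q\<in>cubes. weight_of w Q > 0}.
          (\<integral>\<^sup>+x\<in>Q. ennreal (\<bar>b x - average b Q\<bar> * w x) \<partial>lebesgue) / weight_of w Q)"

end

theory Submission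
  imports Defs
begin

text \<open>
  Both inequalities are proved on each cube \<open>Q\<close> separately. Write \<open>f = w \<chi>\<^sub>Q\<close> and \<open>n\<close> for the dimension.

  \<^emph>\<open>The maximal integral is controlled by oscillations.\<close> Classically \<open>b = log (M f)\<close> has bounded BMO
  norm, and the integral of \<open>M f\<close> over \<open>Q\<close> is comparable to \<open>w(Q)\<close> plus that of \<open>w\<close> times the positive part of
  \<open>log (M f / w\<^sub>Q)\<close>, where \<open>w\<^sub>Q = w(Q)/|Q|\<close>. The logarithm is replaced here by the function which counts the \<open>k < m\<close> with
  \<open>M f > 2\<^sup>k w\<^sub>Q\<close>. It is bounded, and its BMO norm is bounded independently of \<open>m\<close> because of a weak
  \<open>A\<^sub>1\<close> property of \<open>M f\<close> (\<open>maximal_weak_A1\<close>): relative to any value that \<open>M f\<close> takes on a cube \<open>R\<close>, its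
  distribution function on \<open>R\<close> decays like \<open>1/t\<close>. The comparison of integrals rests on the weak type inequality
  \<open>t |{M f > t}| \<le> 3\<^sup>n w({M f > t} \<inter> Q)\<close> (\<open>maximal_weak_type\<close>), summed over \<open>t = 2\<^sup>k w\<^sub>Q\<close>. What remains is a multiple
  of \<open>w(Q)\<close>, which is absorbed since an indicator function already makes the weighted
  oscillation at least \<open>2\<^sup>-\<^sup>n\<close>.

  \<^emph>\<open>Oscillations are controlled by the maximal integral.\<close> For \<open>b\<close> of norm at most 1, select the maximal
  dyadic subcubes of \<open>Q\<close> on which the average of \<open>b\<close> differs from \<open>b\<^sub>Q\<close> by more than 2. They fill at most half
  of \<open>Q\<close>. Outside of them \<open>|b - b\<^sub>Q|\<close> is bounded up to the error of the final scale; on each of them it is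
  at most \<open>2 + 2\<^sup>n\<close> plus the oscillation relative to the new average, and the argument is repeated there. Each cube \<open>R\<close> of this
  construction contributes a multiple of \<open>w(R)\<close>, and this is paid by the integral of \<open>M f\<close> over the part of \<open>R\<close>
  outside the next generation: that part has measure at least \<open>|R|/2\<close>, and \<open>M f\<close> is at least
  \<open>w(R)/|R|\<close> on it. The parts are disjoint, so the total is a multiple of the integral of \<open>M f\<close> over \<open>Q\<close>.
  The induction (\<open>controlled_exists\<close>) runs over finitely many generations; it starts at a scale at
  which the truncated weight is constant up to a small error in mean.
\<close>

section \<open>Cubes\<close>

(* As a simplification rule this replaces the measure of every Lebesgue set by that of its Borel part. *)
declare emeasure_completion [simp del]

lemma divide_times_cancel_ennreal: "m \<noteq> 0 \<Longrightarrow> m \<noteq> top \<Longrightarrow> x / m * m = (x :: ennreal)"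
  by (simp add: ennreal_divide_times top.not_eq_extremum)

text \<open>Membership in a cube is a statement about coordinates, and corner and side length are needed as
  parameters in the covering and subdivision arguments.\<close>

definition cube :: "real ^ 'n \<Rightarrow> real \<Rightarrow> (real ^ 'n) set" where
  "cube a l = cbox a (a + (\<chi> i. l))"

lemma mem_cube: "x \<in> cube a l \<longleftrightarrow> (\<forall>i. a $ i \<le> x $ i \<and> x $ i \<le> a $ i + l)"
  by (simp add: cube_def mem_box_cart)

lemma cubes_iff: "Q \<in> cubes \<longleftrightarrow> (\<exists>a l. l > 0 \<and> Q = cube a l)"
  by (simp add: cubes_def cube_def)

lemma cube_in_cubes: "l > 0 \<Longrightarrow> cube a l \<in> cubes"
  by (auto simp: cubes_iff)

lemma compact_cube: "compact (cube a l)"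
  by (simp add: cube_def compact_cbox)

lemma sets_cube [measurable, simp]: "cube a l \<in> sets lebesgue"
  by (simp add: cube_def)

lemma emeasure_cube:
  fixes a :: "real ^ 'n"
  assumes "l > 0" shows "emeasure lebesgue (cube a l) = ennreal (l ^ CARD('n))"
proof -
  have "a \<in> cube a l" using assms by (simp add: mem_cube)
  then have "measure lborel (cube a l) = l ^ CARD('n)"
    unfolding cube_def by (subst content_cbox_cart) auto
  moreover have "measure lebesgue (cube a l) = measure lborel (cube a l)"
    unfolding cube_def by (rule measure_completion) simp
  moreover have "emeasure lebesgue (cube a l) = ennreal (measure lebesgue (cube a l))"
    unfolding cube_def by (intro emeasure_eq_ennreal_measure fmeasurableD2 lmeasurable_cbox)
  ultimately show ?thesis by simp
qed

lemma sets_cubes [simp]: "Q \<in> cubes \<Longrightarrow> Q \<in> sets lebesgue"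
  by (auto simp: cubes_iff)

lemma emeasure_cubes:
  fixes Q :: "(real ^ 'n) set"
  assumes "Q \<in> cubes"
  shows "0 < measure lebesgue Q" "emeasure lebesgue Q = ennreal (measure lebesgue Q)"
    "emeasure lebesgue Q \<noteq> 0" "emeasure lebesgue Q \<noteq> top"
proof -
  obtain a l where Q: "l > 0" "Q = cube a l" using assms by (auto simp: cubes_iff)
  have "emeasure lebesgue Q = ennreal (l ^ CARD('n))" using emeasure_cube Q by auto
  then show "0 < measure lebesgue Q" "emeasure lebesgue Q = ennreal (measure lebesgue Q)"
    "emeasure lebesgue Q \<noteq> 0" "emeasure lebesgue Q \<noteq> top"
    using Q(1) by (auto simp: measure_def)
qed

definition tripled :: "real ^ 'n \<Rightarrow> real \<Rightarrow> (real ^ 'n) set" where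
  "tripled a l = cube (a - (\<chi> i. l)) (3 * l)"

lemma emeasure_tripled:
  fixes a :: "real ^ 'n"
  assumes "l > 0"
  shows "emeasure lebesgue (tripled a l) = 3 ^ CARD('n) * emeasure lebesgue (cube a l)"
  using assms by (simp add: tripled_def emeasure_cube power_mult_distrib ennreal_mult' ennreal_power flip: ennreal_numeral)

lemma cube_subset_tripled:
  assumes "cube a l \<inter> cube a' l' \<noteq> {}" "l' \<le> l"
  shows "cube a' l' \<subseteq> tripled a l"
proof
  fix y assume y: "y \<in> cube a' l'"
  obtain x where x: "x \<in> cube a l" "x \<in> cube a' l'" using assms by auto
  show "y \<in> tripled a l"
    unfolding tripled_def mem_cube
  proof (intro allI)
    fix i
    show "(a - (\<chi> i. l)) $ i \<le> y $ i \<and> y $ i \<le> (a - (\<chi> i. l)) $ i + 3 * l"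
      using x[unfolded mem_cube, rule_format, of i] y[unfolded mem_cube, rule_format, of i] assms(2)
      by simp
  qed
qed

lemma tripled_in_cubes: "l > 0 \<Longrightarrow> tripled a l \<in> cubes"
  unfolding tripled_def by (rule cube_in_cubes) simp

lemma cube_subset_own_tripled: "l > 0 \<Longrightarrow> cube a l \<subseteq> tripled a l"
proof -
  assume "l > 0"
  then have "a \<in> cube a l \<inter> cube a l" by (simp add: mem_cube)
  then show "cube a l \<subseteq> tripled a l" by (intro cube_subset_tripled) auto
qed

text \<open>The greedy choice of a largest cube works as for balls: every cube that meets it is no larger, so
  its triple swallows all of them, and induction disposes of the cubes that miss it.\<close>

lemma vitali_cubes:
  fixes F :: "((real ^ 'n) \<times> real) set"
  assumes "finite F" "\<And>p. p \<in> F \<Longrightarrow> snd p > 0"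
  shows "\<exists>G\<subseteq>F. disjoint_family_on (\<lambda>p. cube (fst p) (snd p)) G \<and>
           (\<Union>p\<in>F. cube (fst p) (snd p)) \<subseteq> (\<Union>p\<in>G. tripled (fst p) (snd p))"
  using assms
proof (induction F rule: finite_psubset_induct)
  case (psubset F)
  show ?case
  proof (cases "F = {}")
    case True
    then show ?thesis by (intro exI[of _ "{}"]) (simp add: disjoint_family_on_def)
  next
    case False
    then have "Max (snd ` F) \<in> snd ` F" using psubset.hyps by (intro Max_in) simp_all
    then obtain p where p': "p \<in> F" "snd p = Max (snd ` F)" by auto
    then have p: "p \<in> F" "\<And>q. q \<in> F \<Longrightarrow> snd q \<le> snd p"
      using psubset.hyps(1) by (simp_all add: Max_ge)
    define F' where "F' = {q \<in> F. cube (fst q) (snd q) \<inter> cube (fst p) (snd p) = {}}"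
    have "fst p \<in> cube (fst p) (snd p)" using psubset.prems[OF p(1)] by (simp add: mem_cube)
    then have "p \<notin> F'" unfolding F'_def by blast
    then have sub: "F' \<subset> F" using p by (auto simp: F'_def)
    obtain G where G: "G \<subseteq> F'" "disjoint_family_on (\<lambda>p. cube (fst p) (snd p)) G"
      "(\<Union>p\<in>F'. cube (fst p) (snd p)) \<subseteq> (\<Union>p\<in>G. tripled (fst p) (snd p))"
    proof -
      have "snd q > 0" if "q \<in> F'" for q using psubset.prems that sub by blast
      from psubset.IH[OF sub this] show ?thesis using that by blast
    qed
    show ?thesis
    proof (intro exI[of _ "insert p G"] conjI)
      show "insert p G \<subseteq> F" using G(1) sub p(1) by blast
      show "disjoint_family_on (\<lambda>p. cube (fst p) (snd p)) (insert p G)"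
        unfolding disjoint_family_on_def
      proof (intro ballI impI)
        have pq: "cube (fst q) (snd q) \<inter> cube (fst p) (snd p) = {}" if "q \<in> G" for q
          using G(1) that by (auto simp: F'_def)
        fix q r assume "q \<in> insert p G" "r \<in> insert p G" "q \<noteq> r"
        then consider "q \<in> G" "r \<in> G" | "q = p" "r \<in> G" | "q \<in> G" "r = p" by blast
        then show "cube (fst q) (snd q) \<inter> cube (fst r) (snd r) = {}"
          using pq G(2) \<open>q \<noteq> r\<close> unfolding disjoint_family_on_def by cases (simp_all, blast+)
      qed
      show "(\<Union>p\<in>F. cube (fst p) (snd p)) \<subseteq> (\<Union>p\<in>insert p G. tripled (fst p) (snd p))"
      proof
        fix x assume "x \<in> (\<Union>p\<in>F. cube (fst p) (snd p))"
        then obtain q where q: "q \<in> F" "x \<in> cube (fst q) (snd q)" by auto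
        show "x \<in> (\<Union>p\<in>insert p G. tripled (fst p) (snd p))"
        proof (cases "q \<in> F'")
          case True
          then show ?thesis using G(3) q by auto
        next
          case False
          then have "cube (fst p) (snd p) \<inter> cube (fst q) (snd q) \<noteq> {}" using q by (auto simp: F'_def)
          from cube_subset_tripled[OF this p(2)[OF q(1)]] show ?thesis using q by auto
        qed
      qed
    qed
  qed
qed

section \<open>The maximal function\<close>

text \<open>Clearing the denominator once and for all avoids division in the covering and localisation
  arguments.\<close>

lemma less_maximal_iff:
  "t < maximal g x \<longleftrightarrow>
    (\<exists>a l. l > 0 \<and> x \<in> cube a l \<and> t * emeasure lebesgue (cube a l) < (\<integral>\<^sup>+y\<in>cube a l. ennreal \<bar>g y\<bar> \<partial>lebesgue))"
proof -
  have *: "t < I / emeasure lebesgue R \<longleftrightarrow> t * emeasure lebesgue R < I" if "R \<in> cubes" for R :: "(real^'n) set" and I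
  proof -
    define m where "m = emeasure lebesgue R"
    have m: "m \<noteq> 0" "m \<noteq> top" using emeasure_cubes(3,4)[OF that] by (auto simp: m_def)
    have "I / m * m = I"
      using m by (rule divide_times_cancel_ennreal)
    moreover have "t < I / m \<Longrightarrow> t * m < I / m * m"
      using m by (intro ennreal_mult_strict_right_mono) (auto simp: top.not_eq_extremum zero_less_iff_neq_zero)
    moreover have "I / m \<le> t \<Longrightarrow> I / m * m \<le> t * m"
      by (intro mult_right_mono) auto
    ultimately show ?thesis unfolding m_def by (metis not_le)
  qed
  show ?thesis
    unfolding maximal_def less_SUP_iff
  proof (intro iffI)
    assume "\<exists>R\<in>{R \<in> cubes. x \<in> R}. t < (\<integral>\<^sup>+y\<in>R. ennreal \<bar>g y\<bar> \<partial>lebesgue) / emeasure lebesgue R"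
    then obtain R where R: "R \<in> cubes" "x \<in> R"
      "t < (\<integral>\<^sup>+y\<in>R. ennreal \<bar>g y\<bar> \<partial>lebesgue) / emeasure lebesgue R" by blast
    moreover obtain a l where "l > 0" "R = cube a l" using R(1) cubes_iff by blast
    ultimately show "\<exists>a l. l > 0 \<and> x \<in> cube a l \<and>
        t * emeasure lebesgue (cube a l) < (\<integral>\<^sup>+y\<in>cube a l. ennreal \<bar>g y\<bar> \<partial>lebesgue)"
      using *[OF R(1)] by blast
  next
    assume "\<exists>a l. l > 0 \<and> x \<in> cube a l \<and>
        t * emeasure lebesgue (cube a l) < (\<integral>\<^sup>+y\<in>cube a l. ennreal \<bar>g y\<bar> \<partial>lebesgue)"
    then show "\<exists>R\<in>{R \<in> cubes. x \<in> R}. t < (\<integral>\<^sup>+y\<in>R. ennreal \<bar>g y\<bar> \<partial>lebesgue) / emeasure lebesgue R"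
      using * cube_in_cubes by blast
  qed
qed

text \<open>A closed cube whose average exceeds \<open>t\<close> strictly may be enlarged a little without losing this
  property, because the integral can only grow and the volume depends continuously on the side. So
  the interiors of such cubes already cover the superlevel set; this gives openness, and it is what
  the Lindelof theorem needs below.\<close>

lemma superlevel_maximal:
  fixes g :: "real ^ 'n \<Rightarrow> real"
  assumes t: "0 \<le> t"
  shows "{x. ennreal t < maximal g x} =
    (\<Union>p\<in>{(a, l). l > 0 \<and> ennreal t * emeasure lebesgue (cube a l)
                          < (\<integral>\<^sup>+y\<in>cube a l. ennreal \<bar>g y\<bar> \<partial>lebesgue)}. interior (cube (fst p) (snd p)))"
    (is "?U = (\<Union>p\<in>?P. _)")
proof (intro equalityI subsetI)
  fix x assume "x \<in> ?U"
  then obtain a l where al: "l > 0" "x \<in> cube a l" and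
    lt: "ennreal t * emeasure lebesgue (cube a l) < (\<integral>\<^sup>+y\<in>cube a l. ennreal \<bar>g y\<bar> \<partial>lebesgue)"
    unfolding less_maximal_iff mem_Collect_eq by blast
  let ?I = "\<integral>\<^sup>+y\<in>cube a l. ennreal \<bar>g y\<bar> \<partial>lebesgue"
  have "((\<lambda>e. ennreal (t * (l + 2 * e) ^ CARD('n))) \<longlongrightarrow> ennreal (t * (l + 2 * 0) ^ CARD('n))) (at_right 0)"
    by (intro tendsto_intros)
  moreover have "ennreal (t * (l + 2 * 0) ^ CARD('n)) < ?I"
    using lt al t by (simp add: emeasure_cube ennreal_mult)
  ultimately have "\<forall>\<^sub>F e in at_right 0. ennreal (t * (l + 2 * e) ^ CARD('n)) < ?I"
    by (rule order_tendstoD)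
  then obtain e where e: "e > 0" "ennreal (t * (l + 2 * e) ^ CARD('n)) < ?I"
    by (metis (lifting) dense eventually_at_right_field)
  let ?a = "a - (\<chi> i. e)" and ?l = "l + 2 * e"
  have sub: "cube a l \<subseteq> cube ?a ?l"
  proof
    fix y assume y: "y \<in> cube a l"
    show "y \<in> cube ?a ?l" unfolding mem_cube
    proof
      fix i
      show "?a $ i \<le> y $ i \<and> y $ i \<le> ?a $ i + ?l"
        using y[unfolded mem_cube, rule_format, of i] e(1) by simp
    qed
  qed
  have "ennreal t * emeasure lebesgue (cube ?a ?l) < ?I"
    using e al t by (simp add: emeasure_cube ennreal_mult)
  also have "?I \<le> (\<integral>\<^sup>+y\<in>cube ?a ?l. ennreal \<bar>g y\<bar> \<partial>lebesgue)"
    using sub by (intro nn_integral_mono) (auto split: split_indicator)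
  finally have "(?a, ?l) \<in> ?P" using e al by simp
  moreover have "x \<in> interior (cube ?a ?l)"
    unfolding cube_def interior_cbox mem_box_cart
  proof
    fix i
    show "?a $ i < x $ i \<and> x $ i < (?a + (\<chi> i. ?l)) $ i"
      using al(2)[unfolded mem_cube, rule_format, of i] e(1) by simp
  qed
  ultimately show "x \<in> (\<Union>p\<in>?P. interior (cube (fst p) (snd p)))" by force
next
  fix x assume "x \<in> (\<Union>p\<in>?P. interior (cube (fst p) (snd p)))"
  then obtain a l where "(a, l) \<in> ?P" "x \<in> interior (cube a l)" by force
  then show "x \<in> ?U" using interior_subset unfolding mem_Collect_eq less_maximal_iff by blast
qed

lemma open_superlevel_maximal:
  assumes "0 \<le> t" shows "open {x. ennreal t < maximal g x}"
  unfolding superlevel_maximal[OF assms] by blast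

lemma borel_measurable_maximal [measurable]:
  fixes g :: "real ^ 'n \<Rightarrow> real"
  shows "maximal g \<in> borel_measurable lebesgue"
proof (rule borel_measurableI_greater)
  fix y :: ennreal
  show "{x \<in> space lebesgue. y < maximal g x} \<in> sets lebesgue"
  proof (cases y)
    case (real t)
    then have "open {x. y < maximal g x}" using open_superlevel_maximal by blast
    then show ?thesis by simp
  next
    case top
    then show ?thesis by simp
  qed
qed

text \<open>Every selected cube lies entirely inside the superlevel set, which is why the right-hand side
  integrates over the superlevel set only. This is stronger than the usual weak (1,1) bound; summed
  over dyadic levels it compares \<open>M g\<close> with \<open>|g| log (M g)\<close> without truncating \<open>g\<close>.\<close>

lemma maximal_weak_type:
  fixes g :: "real ^ 'n \<Rightarrow> real"
  assumes g [measurable]: "g \<in> borel_measurable lebesgue" and t: "0 \<le> t"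
  defines "U \<equiv> {x. ennreal t < maximal g x}"
  shows "ennreal t * emeasure lebesgue U \<le> 3 ^ CARD('n) * (\<integral>\<^sup>+x\<in>U. ennreal \<bar>g x\<bar> \<partial>lebesgue)"
proof -
  let ?c = "\<lambda>p :: (real ^ 'n) \<times> real. cube (fst p) (snd p)"
  let ?I = "\<lambda>S. \<integral>\<^sup>+x\<in>S. ennreal \<bar>g x\<bar> \<partial>lebesgue"
  define P where "P = {(a :: real ^ 'n, l). l > 0 \<and> ennreal t * emeasure lebesgue (cube a l) < ?I (cube a l)}"
  have U: "U = (\<Union>p\<in>P. interior (?c p))"
    unfolding U_def P_def using superlevel_maximal[OF t] .
  have cU: "?c p \<subseteq> U" if "p \<in> P" for p
  proof
    fix x assume "x \<in> ?c p"
    moreover have "snd p > 0 \<and> ennreal t * emeasure lebesgue (?c p) < ?I (?c p)"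
      using that unfolding P_def by (simp add: case_prod_beta)
    ultimately show "x \<in> U" unfolding U_def less_maximal_iff mem_Collect_eq by blast
  qed
  have openU: "open U" unfolding U_def by (rule open_superlevel_maximal[OF t])
  then have [measurable]: "U \<in> sets lebesgue" by simp
  have fin: "ennreal t * emeasure lebesgue (\<Union>p\<in>F. ?c p) \<le> 3 ^ CARD('n) * ?I U"
    if F: "finite F" "F \<subseteq> P" for F
  proof -
    have pos: "snd p > 0" if "p \<in> F" for p using F that by (auto simp: P_def)
    obtain G where G: "G \<subseteq> F" "disjoint_family_on ?c G"
      "(\<Union>p\<in>F. ?c p) \<subseteq> (\<Union>p\<in>G. tripled (fst p) (snd p))"
      using vitali_cubes[OF F(1) pos] by blast
    have finG: "finite G" using G(1) F(1) by (rule finite_subset)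
    have "emeasure lebesgue (\<Union>p\<in>F. ?c p) \<le> emeasure lebesgue (\<Union>p\<in>G. tripled (fst p) (snd p))"
      using finG by (intro emeasure_mono G sets.finite_UN) (auto simp: tripled_def)
    also have "\<dots> \<le> (\<Sum>p\<in>G. emeasure lebesgue (tripled (fst p) (snd p)))"
      using finG by (intro emeasure_subadditive_finite) (auto simp: tripled_def)
    also have "\<dots> = (\<Sum>p\<in>G. 3 ^ CARD('n) * emeasure lebesgue (?c p))"
      using pos G(1) by (intro sum.cong refl emeasure_tripled) auto
    finally have "ennreal t * emeasure lebesgue (\<Union>p\<in>F. ?c p)
        \<le> ennreal t * (\<Sum>p\<in>G. 3 ^ CARD('n) * emeasure lebesgue (?c p))"
      by (rule mult_left_mono) simp
    also have "\<dots> = 3 ^ CARD('n) * (\<Sum>p\<in>G. ennreal t * emeasure lebesgue (?c p))"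
      by (simp add: sum_distrib_left mult_ac)
    also have "\<dots> \<le> 3 ^ CARD('n) * (\<Sum>p\<in>G. ?I (?c p))"
    proof (intro mult_left_mono sum_mono)
      fix p assume "p \<in> G"
      then have "p \<in> P" using G(1) F(2) by blast
      then show "ennreal t * emeasure lebesgue (?c p) \<le> ?I (?c p)" by (auto simp: P_def)
    qed simp
    also have "(\<Sum>p\<in>G. ?I (?c p)) = (\<integral>\<^sup>+x. (\<Sum>p\<in>G. ennreal \<bar>g x\<bar> * indicator (?c p) x) \<partial>lebesgue)"
      by (intro nn_integral_sum[symmetric]) simp
    also have "\<dots> \<le> ?I U"
    proof (intro nn_integral_mono)
      fix x
      have "(\<Sum>p\<in>G. indicator (?c p) x) = (indicator (\<Union>p\<in>G. ?c p) x :: ennreal)"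
        using G(2) finG by (simp add: indicator_UN_disjoint)
      also have "\<dots> \<le> indicator U x"
        using cU G(1) F(2) by (simp only: ennreal_indicator_less) blast
      finally have "ennreal \<bar>g x\<bar> * (\<Sum>p\<in>G. indicator (?c p) x) \<le> ennreal \<bar>g x\<bar> * indicator U x"
        by (rule mult_left_mono) simp
      then show "(\<Sum>p\<in>G. ennreal \<bar>g x\<bar> * indicator (?c p) x) \<le> ennreal \<bar>g x\<bar> * indicator U x"
        by (simp add: sum_distrib_left)
    qed
    finally show ?thesis by (simp add: mult_left_mono)
  qed
  show ?thesis
  proof (cases "U = {}")
    case True
    then show ?thesis by simp
  next
    case False
    \<comment> \<open>Countably many cubes suffice, and finitely many of them exhaust the measure.\<close>
    have "open S" if "S \<in> (\<lambda>p. interior (?c p)) ` P" for S using that by auto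
    then obtain \<F> where \<F>: "\<F> \<subseteq> (\<lambda>p. interior (?c p)) ` P" "countable \<F>" "\<Union>\<F> = U"
      unfolding U by (rule Lindelof)
    obtain P' where P': "P' \<subseteq> P" "countable P'" "(\<lambda>p. interior (?c p)) ` P' = \<F>"
      using \<F>(1,2) countable_subset_image[of \<F> "\<lambda>p. interior (?c p)" P] by blast
    have UP: "U = (\<Union>p\<in>P'. ?c p)"
    proof
      show "U \<subseteq> (\<Union>p\<in>P'. ?c p)"
        unfolding \<F>(3)[symmetric] P'(3)[symmetric] by (intro UN_mono order.refl interior_subset)
      show "(\<Union>p\<in>P'. ?c p) \<subseteq> U" using cU P'(1) by (intro UN_least) auto
    qed
    have ne: "P' \<noteq> {}" using False UP by auto
    define A where "A m = (\<Union>p\<in>from_nat_into P' ` {..<m}. ?c p)" for m :: nat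
    have [measurable]: "A m \<in> sets lebesgue" for m unfolding A_def by (intro sets.finite_UN) auto
    have "(\<Union>m. A m) = U"
    proof -
      have "(\<Union>m. A m) = (\<Union>k. ?c (from_nat_into P' k))" unfolding A_def by blast
      also have "\<dots> = (\<Union>p\<in>range (from_nat_into P'). ?c p)" by blast
      finally show ?thesis using UP range_from_nat_into[OF ne P'(2)] by simp
    qed
    moreover have "incseq A" unfolding A_def incseq_def by (intro allI impI UN_mono image_mono) auto
    ultimately have "emeasure lebesgue U = (SUP m. emeasure lebesgue (A m))"
      using SUP_emeasure_incseq[of A lebesgue] by (simp add: image_subset_iff)
    moreover have "ennreal t * emeasure lebesgue (A m) \<le> 3 ^ CARD('n) * ?I U" for m
      unfolding A_def using from_nat_into[OF ne] P'(1) by (intro fin) auto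
    ultimately show ?thesis by (simp add: SUP_mult_left_ennreal SUP_least)
  qed
qed

lemma average_le_maximal:
  assumes "Q \<in> cubes" "x \<in> Q"
  shows "(\<integral>\<^sup>+y\<in>Q. ennreal \<bar>g y\<bar> \<partial>lebesgue) \<le> maximal g x * emeasure lebesgue Q"
proof -
  define m where "m = emeasure lebesgue Q"
  have m: "m \<noteq> 0" "m \<noteq> top" using emeasure_cubes(3,4)[OF assms(1)] by (auto simp: m_def)
  have "(\<integral>\<^sup>+y\<in>Q. ennreal \<bar>g y\<bar> \<partial>lebesgue) / m \<le> maximal g x"
    unfolding maximal_def m_def using assms by (intro SUP_upper) auto
  then have "(\<integral>\<^sup>+y\<in>Q. ennreal \<bar>g y\<bar> \<partial>lebesgue) / m * m \<le> maximal g x * m"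
    by (rule mult_right_mono) simp
  then show ?thesis using m by (simp add: divide_times_cancel_ennreal m_def)
qed

text \<open>A weak form of the theorem of Coifman and Rochberg that a power of \<open>M g\<close> is an
  \<open>A\<^sub>1\<close> weight. Only levels above \<open>3\<^sup>n M g(y)\<close> matter. At such a level, a cube that meets
  \<open>R\<close> and is larger than \<open>R\<close> would after tripling contain \<open>y\<close> and give \<open>M g(y)\<close> too large a value;
  so all relevant cubes lie in the triple of \<open>R\<close>, and the weak type bound applies to \<open>g\<close> restricted to it.
  The factor \<open>9\<^sup>n\<close> is \<open>3\<^sup>n\<close> from the weak type bound times \<open>3\<^sup>n\<close> from the volume of the triple.\<close>

lemma maximal_weak_A1:
  fixes g :: "real ^ 'n \<Rightarrow> real"
  assumes g [measurable]: "g \<in> borel_measurable lebesgue" and t: "0 \<le> t"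
    and R: "R \<in> cubes" and y: "y \<in> R"
  shows "ennreal t * emeasure lebesgue (R \<inter> {x. ennreal t < maximal g x})
    \<le> 9 ^ CARD('n) * (maximal g y * emeasure lebesgue R)"
proof -
  obtain a l where al: "l > 0" and Rdef: "R = cube a l" using R cubes_iff by blast
  let ?T = "tripled a l"
  have three_nine: "(3::ennreal) ^ CARD('n) * 3 ^ CARD('n) = 9 ^ CARD('n)"
    by (simp flip: power_mult_distrib)
  have meas: "{x. ennreal t < maximal h x} \<in> sets lebesgue" for h :: "real ^ 'n \<Rightarrow> real"
    using open_superlevel_maximal[OF t, of h] by simp
  have [measurable]: "R \<in> sets lebesgue" using R by simp
  show ?thesis
  proof (cases "ennreal t < 3 ^ CARD('n) * maximal g y")
    case True
    have "ennreal t * emeasure lebesgue (R \<inter> {x. ennreal t < maximal g x}) \<le> ennreal t * emeasure lebesgue R"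
      by (intro mult_left_mono emeasure_mono) auto
    also have "\<dots> \<le> (3 ^ CARD('n) * maximal g y) * emeasure lebesgue R"
      using True by (intro mult_right_mono) auto
    also have "\<dots> \<le> (9 ^ CARD('n) * maximal g y) * emeasure lebesgue R"
      by (intro mult_right_mono power_mono) auto
    finally show ?thesis by (simp add: mult.assoc)
  next
    case False
    define h where "h x = g x * indicator ?T x" for x
    have Tm [measurable]: "?T \<in> sets lebesgue" by (simp add: tripled_def)
    have [measurable]: "h \<in> borel_measurable lebesgue" unfolding h_def by measurable
    have "R \<inter> {x. ennreal t < maximal g x} \<subseteq> {x. ennreal t < maximal h x}"
    proof safe
      fix x assume x: "x \<in> R" "ennreal t < maximal g x"
      then obtain b k where bk: "k > 0" "x \<in> cube b k" and
        lt: "ennreal t * emeasure lebesgue (cube b k) < (\<integral>\<^sup>+y\<in>cube b k. ennreal \<bar>g y\<bar> \<partial>lebesgue)"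
        unfolding less_maximal_iff by blast
      show "ennreal t < maximal h x"
      proof (cases "k \<le> l")
        case True
        then have sub: "cube b k \<subseteq> ?T"
          using x bk(2) unfolding Rdef by (intro cube_subset_tripled) auto
        have "(\<integral>\<^sup>+y\<in>cube b k. ennreal \<bar>g y\<bar> \<partial>lebesgue) = (\<integral>\<^sup>+y\<in>cube b k. ennreal \<bar>h y\<bar> \<partial>lebesgue)"
          using sub by (intro nn_integral_cong) (auto simp: h_def split: split_indicator)
        then show ?thesis unfolding less_maximal_iff using bk lt by metis
      next
        case big: False
        have sub: "cube a l \<subseteq> tripled b k"
          using big x bk(2) unfolding Rdef by (intro cube_subset_tripled) auto
        have "ennreal t * emeasure lebesgue (cube b k) < (\<integral>\<^sup>+y\<in>cube b k. ennreal \<bar>g y\<bar> \<partial>lebesgue)" by (rule lt)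
        also have "\<dots> \<le> (\<integral>\<^sup>+y\<in>tripled b k. ennreal \<bar>g y\<bar> \<partial>lebesgue)"
          using cube_subset_own_tripled[OF bk(1)] by (intro nn_integral_mono) (auto split: split_indicator)
        also have "\<dots> \<le> maximal g y * emeasure lebesgue (tripled b k)"
          using y sub Rdef by (intro average_le_maximal tripled_in_cubes bk(1)) auto
        also have "\<dots> = (3 ^ CARD('n) * maximal g y) * emeasure lebesgue (cube b k)"
          by (simp add: emeasure_tripled[OF bk(1)] mult_ac)
        also have "\<dots> \<le> ennreal t * emeasure lebesgue (cube b k)"
          using False by (intro mult_right_mono) auto
        finally show ?thesis by simp
      qed
    qed
    then have "ennreal t * emeasure lebesgue (R \<inter> {x. ennreal t < maximal g x})
        \<le> ennreal t * emeasure lebesgue {x. ennreal t < maximal h x}"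
      by (intro mult_left_mono emeasure_mono meas) auto
    also have "\<dots> \<le> 3 ^ CARD('n) * (\<integral>\<^sup>+x\<in>{x. ennreal t < maximal h x}. ennreal \<bar>h x\<bar> \<partial>lebesgue)"
      by (rule maximal_weak_type) (use t in auto)
    also have "\<dots> \<le> 3 ^ CARD('n) * (\<integral>\<^sup>+x\<in>?T. ennreal \<bar>g x\<bar> \<partial>lebesgue)"
      by (intro mult_left_mono nn_integral_mono) (auto simp: h_def split: split_indicator)
    also have "\<dots> \<le> 3 ^ CARD('n) * (maximal g y * emeasure lebesgue ?T)"
      using y cube_subset_own_tripled[OF al] Rdef by (intro mult_left_mono average_le_maximal tripled_in_cubes al) auto
    also have "\<dots> = 9 ^ CARD('n) * (maximal g y * emeasure lebesgue R)"
      unfolding emeasure_tripled[OF al] Rdef three_nine[symmetric] by (simp add: mult_ac)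
    finally show ?thesis .
  qed
qed

section \<open>Oscillation\<close>

lemma locally_integrable_on_cube:
  "locally_integrable f \<Longrightarrow> Q \<in> cubes \<Longrightarrow> set_integrable lebesgue Q f"
  unfolding locally_integrable_def using compact_cube cubes_iff by metis

lemma locally_integrable_measurable:
  fixes f :: "real ^ 'n \<Rightarrow> real"
  assumes "locally_integrable f"
  shows "f \<in> borel_measurable lebesgue"
proof -
  have "f integrable_on cbox a b" for a b
    using assms unfolding locally_integrable_def
    by (intro set_lebesgue_integral_eq_integral(1)) (simp add: compact_cbox)
  then have "f measurable_on UNIV" by (rule integrable_subintervals_imp_measurable)
  then show ?thesis
    using measurable_on_iff_borel_measurable[of UNIV f] by (simp add: lebesgue_on_UNIV_eq)
qed

lemma weight_measurable: "is_weight w \<Longrightarrow> w \<in> borel_measurable lebesgue"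
  by (simp add: is_weight_def locally_integrable_measurable)

lemma weight_of_finite:
  assumes "is_weight w" "Q \<in> cubes"
  shows "weight_of w Q < top"
proof -
  have "set_integrable lebesgue Q w"
    using assms by (simp add: is_weight_def locally_integrable_on_cube)
  then have "(\<integral>\<^sup>+x. norm (indicator Q x *\<^sub>R w x) \<partial>lebesgue) < \<infinity>"
    unfolding set_integrable_def by (simp add: integrable_iff_bounded)
  also have "(\<integral>\<^sup>+x. norm (indicator Q x *\<^sub>R w x) \<partial>lebesgue) = weight_of w Q"
    unfolding weight_of_def using assms(1)
    by (intro nn_integral_cong) (auto simp: is_weight_def split: split_indicator)
  finally show ?thesis by simp
qed

lemma average_diff_le:
  assumes b: "locally_integrable b" and Q: "Q \<in> cubes"
  shows "ennreal \<bar>average b Q - c\<bar> * emeasure lebesgue Q \<le> (\<integral>\<^sup>+x\<in>Q. ennreal \<bar>b x - c\<bar> \<partial>lebesgue)"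
proof -
  let ?m = "measure lebesgue Q"
  have m: "?m > 0" "emeasure lebesgue Q = ennreal ?m" using emeasure_cubes[OF Q] by auto
  have Qf: "Q \<in> fmeasurable lebesgue" using Q m by (intro fmeasurableI) auto
  have i1: "set_integrable lebesgue Q b" using b Q by (rule locally_integrable_on_cube)
  have i2: "set_integrable lebesgue Q (\<lambda>x. c)"
    using Qf unfolding set_integrable_def by (simp add: fmeasurable_def)
  have "(LINT x:Q|lebesgue. b x - c) = (LINT x:Q|lebesgue. b x) - (LINT x:Q|lebesgue. c)"
    using i1 i2 by (rule set_integral_diff(2))
  also have "(LINT x:Q|lebesgue. c) = c * ?m"
    unfolding set_lebesgue_integral_def using Qf by simp
  also have "(LINT x:Q|lebesgue. b x) - c * ?m = (average b Q - c) * ?m"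
    using m(1) by (simp add: average_def field_simps)
  finally have eq: "(average b Q - c) * ?m = (LINT x:Q|lebesgue. b x - c)" by simp
  have "integrable lebesgue (\<lambda>x. indicator Q x *\<^sub>R (b x - c))"
    using set_integral_diff(1)[OF i1 i2] by (simp add: set_integrable_def)
  then have "ennreal \<bar>(LINT x:Q|lebesgue. b x - c)\<bar> \<le> (\<integral>\<^sup>+x. norm (indicator Q x *\<^sub>R (b x - c)) \<partial>lebesgue)"
    unfolding set_lebesgue_integral_def real_norm_def[symmetric] by (rule integral_norm_bound_ennreal)
  also have "\<dots> = (\<integral>\<^sup>+x\<in>Q. ennreal \<bar>b x - c\<bar> \<partial>lebesgue)"
    by (intro nn_integral_cong) (auto split: split_indicator)
  finally show ?thesis
    using m(1) by (simp add: m(2) eq[symmetric] abs_mult ennreal_mult)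
qed

text \<open>The mean minimises the oscillation up to a factor 2, so an upper bound for the BMO norm may use any
  convenient constant on each cube.\<close>

lemma oscillation_le_twice:
  assumes b: "locally_integrable b" and Q: "Q \<in> cubes"
  shows "(\<integral>\<^sup>+x\<in>Q. ennreal \<bar>b x - average b Q\<bar> \<partial>lebesgue) \<le> 2 * (\<integral>\<^sup>+x\<in>Q. ennreal \<bar>b x - c\<bar> \<partial>lebesgue)"
proof -
  have [measurable]: "b \<in> borel_measurable lebesgue" "Q \<in> sets lebesgue"
    using locally_integrable_measurable[OF b] Q by auto
  have "(\<integral>\<^sup>+x\<in>Q. ennreal \<bar>b x - average b Q\<bar> \<partial>lebesgue)
      \<le> (\<integral>\<^sup>+x. ennreal \<bar>b x - c\<bar> * indicator Q x + ennreal \<bar>average b Q - c\<bar> * indicator Q x \<partial>lebesgue)"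
    by (intro nn_integral_mono)
      (auto split: split_indicator simp: ennreal_plus[symmetric] simp del: ennreal_plus intro!: ennreal_leI)
  also have "\<dots> = (\<integral>\<^sup>+x\<in>Q. ennreal \<bar>b x - c\<bar> \<partial>lebesgue) + ennreal \<bar>average b Q - c\<bar> * emeasure lebesgue Q"
    by (subst nn_integral_add) (auto simp: nn_integral_cmult_indicator)
  also have "\<dots> \<le> (\<integral>\<^sup>+x\<in>Q. ennreal \<bar>b x - c\<bar> \<partial>lebesgue) + (\<integral>\<^sup>+x\<in>Q. ennreal \<bar>b x - c\<bar> \<partial>lebesgue)"
    by (intro add_left_mono average_diff_le assms)
  finally show ?thesis by (simp add: mult_2)
qed

lemma BMO_norm_le:
  assumes b: "locally_integrable b"
    and "\<And>R. R \<in> cubes \<Longrightarrow>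
      \<exists>c. 2 * (\<integral>\<^sup>+x\<in>R. ennreal \<bar>b x - c\<bar> \<partial>lebesgue) \<le> B * emeasure lebesgue R"
  shows "BMO_norm b \<le> B"
  unfolding BMO_norm_def
proof (rule SUP_least)
  fix R :: "(real ^ 'a) set" assume R: "R \<in> cubes"
  obtain c where "2 * (\<integral>\<^sup>+x\<in>R. ennreal \<bar>b x - c\<bar> \<partial>lebesgue) \<le> B * emeasure lebesgue R"
    using assms(2)[OF R] by blast
  with oscillation_le_twice[OF b R]
  have "(\<integral>\<^sup>+x\<in>R. ennreal \<bar>b x - average b R\<bar> \<partial>lebesgue) \<le> B * emeasure lebesgue R"
    by (rule order.trans)
  then have "(\<integral>\<^sup>+x\<in>R. ennreal \<bar>b x - average b R\<bar> \<partial>lebesgue) / emeasure lebesgue R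
      \<le> B * emeasure lebesgue R / emeasure lebesgue R"
    by (rule divide_right_mono_ennreal)
  also have "\<dots> = B" using emeasure_cubes(3,4)[OF R] by (rule mult_divide_eq_ennreal)
  finally show "(\<integral>\<^sup>+x\<in>R. ennreal \<bar>b x - average b R\<bar> \<partial>lebesgue) / emeasure lebesgue R \<le> B" .
qed

lemma BMO_oscillation_le:
  assumes R: "R \<in> cubes"
  shows "(\<integral>\<^sup>+x\<in>R. ennreal \<bar>b x - average b R\<bar> \<partial>lebesgue) \<le> BMO_norm b * emeasure lebesgue R"
proof -
  have "(\<integral>\<^sup>+x\<in>R. ennreal \<bar>b x - average b R\<bar> \<partial>lebesgue) / emeasure lebesgue R \<le> BMO_norm b"
    unfolding BMO_norm_def using R by (intro SUP_upper)
  from mult_right_mono[OF this, of "emeasure lebesgue R"] show ?thesis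
    by (simp add: divide_times_cancel_ennreal emeasure_cubes(3,4)[OF R])
qed

text \<open>The supremum defining the weighted oscillation runs over functions of norm exactly 1; scaling
  removes this normalisation. A function of norm 0 cannot be scaled, but it is constant almost
  everywhere on \<open>Q\<close>, and the left-hand side vanishes.\<close>

lemma weighted_oscillation_homogeneous:
  fixes b w :: "real ^ 'n \<Rightarrow> real"
  assumes w: "is_weight w" and b: "locally_integrable b" and fin: "BMO_norm b < top"
    and Q: "Q \<in> cubes" and pos: "weight_of w Q > 0"
  shows "(\<integral>\<^sup>+x\<in>Q. ennreal (\<bar>b x - average b Q\<bar> * w x) \<partial>lebesgue)
    \<le> BMO_norm b * weighted_oscillation w * weight_of w Q"
proof -
  have [measurable]: "b \<in> borel_measurable lebesgue" "Q \<in> sets lebesgue" "w \<in> borel_measurable lebesgue"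
    using locally_integrable_measurable[OF b] Q weight_measurable[OF w] by auto
  have w0: "0 \<le> w x" for x using w by (simp add: is_weight_def)
  obtain r where r: "0 \<le> r" "BMO_norm b = ennreal r" using fin less_top_ennreal by auto
  show ?thesis
  proof (cases "r = 0")
    case True
    then have "(\<integral>\<^sup>+x\<in>Q. ennreal \<bar>b x - average b Q\<bar> \<partial>lebesgue) = 0"
      using BMO_oscillation_le[OF Q, of b] r by simp
    then have "AE x in lebesgue. ennreal \<bar>b x - average b Q\<bar> * indicator Q x = 0"
      by (subst (asm) nn_integral_0_iff_AE) auto
    then have "AE x in lebesgue. ennreal (\<bar>b x - average b Q\<bar> * w x) * indicator Q x = 0"
      by eventually_elim (auto split: split_indicator_asm)
    then have "(\<integral>\<^sup>+x\<in>Q. ennreal (\<bar>b x - average b Q\<bar> * w x) \<partial>lebesgue) = 0"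
      by (subst nn_integral_0_iff_AE) auto
    then show ?thesis by simp
  next
    case False
    then have rp: "r > 0" using r by simp
    define b' where "b' x = b x / r" for x
    have av: "average b' R = average b R / r" for R
      unfolding average_def b'_def set_lebesgue_integral_def by simp
    have scale: "\<bar>b' x - average b' R\<bar> = \<bar>b x - average b R\<bar> / r" for x R
      unfolding av b'_def using rp by (simp add: diff_divide_distrib[symmetric] abs_divide)
    have li: "locally_integrable b'"
      using b unfolding locally_integrable_def b'_def set_integrable_def by (auto simp: )
    have "BMO_norm b' = (SUP R\<in>cubes. ennreal (1 / r) *
        ((\<integral>\<^sup>+x\<in>R. ennreal \<bar>b x - average b R\<bar> \<partial>lebesgue) / emeasure lebesgue R))"
      unfolding BMO_norm_def
    proof (intro SUP_cong refl)
      fix R :: "(real ^ 'n) set" assume "R \<in> cubes"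
      then have [measurable]: "R \<in> sets lebesgue" by simp
      have "(\<integral>\<^sup>+x\<in>R. ennreal \<bar>b' x - average b' R\<bar> \<partial>lebesgue)
          = (\<integral>\<^sup>+x. ennreal (1 / r) * (ennreal \<bar>b x - average b R\<bar> * indicator R x) \<partial>lebesgue)"
        unfolding scale using rp
        by (intro nn_integral_cong) (auto split: split_indicator simp: ennreal_mult'[symmetric])
      also have "\<dots> = ennreal (1 / r) * (\<integral>\<^sup>+x\<in>R. ennreal \<bar>b x - average b R\<bar> \<partial>lebesgue)"
        by (rule nn_integral_cmult) measurable
      finally show "(\<integral>\<^sup>+x\<in>R. ennreal \<bar>b' x - average b' R\<bar> \<partial>lebesgue) / emeasure lebesgue R = ennreal (1 / r) *
        ((\<integral>\<^sup>+x\<in>R. ennreal \<bar>b x - average b R\<bar> \<partial>lebesgue) / emeasure lebesgue R)"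
        by (simp add: ennreal_times_divide)
    qed
    also have "\<dots> = ennreal (1 / r) * BMO_norm b"
      unfolding BMO_norm_def by (rule SUP_mult_left_ennreal[symmetric])
    also have "\<dots> = 1" using rp by (simp add: r(2) ennreal_mult'[symmetric])
    finally have norm1: "BMO_norm b' = 1" .
    have "(\<integral>\<^sup>+x\<in>Q. ennreal (\<bar>b' x - average b' Q\<bar> * w x) \<partial>lebesgue) / weight_of w Q \<le> weighted_oscillation w"
      unfolding weighted_oscillation_def using li norm1 Q pos
      by (intro SUP_upper2[of b'] SUP_upper2[of Q]) auto
    from mult_right_mono[OF this, of "weight_of w Q"]
    have le: "(\<integral>\<^sup>+x\<in>Q. ennreal (\<bar>b' x - average b' Q\<bar> * w x) \<partial>lebesgue) \<le> weighted_oscillation w * weight_of w Q"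
      using pos weight_of_finite[OF w Q] by (simp add: divide_times_cancel_ennreal)
    have "(\<integral>\<^sup>+x\<in>Q. ennreal (\<bar>b x - average b Q\<bar> * w x) \<partial>lebesgue)
        = (\<integral>\<^sup>+x. ennreal r * (ennreal (\<bar>b' x - average b' Q\<bar> * w x) * indicator Q x) \<partial>lebesgue)"
      unfolding scale using rp w0
      by (intro nn_integral_cong) (auto split: split_indicator simp: ennreal_mult'[symmetric])
    also have "\<dots> = ennreal r * (\<integral>\<^sup>+x\<in>Q. ennreal (\<bar>b' x - average b' Q\<bar> * w x) \<partial>lebesgue)"
      unfolding b'_def by (rule nn_integral_cmult) measurable
    also have "\<dots> \<le> ennreal r * (weighted_oscillation w * weight_of w Q)"
      using le by (rule mult_left_mono) simp
    finally show ?thesis by (simp add: r(2) mult.assoc)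
  qed
qed

lemma sum_geometric_decay_le:
  fixes e :: "nat \<Rightarrow> ennreal"
  assumes "\<And>j. ennreal (2 ^ j) * e j \<le> X"
  shows "(\<Sum>j<p. e j) \<le> 2 * X"
proof -
  have e: "e j \<le> ennreal ((1/2) ^ j) * X" for j
  proof -
    have "ennreal ((1/2) ^ j) * (ennreal (2 ^ j) * e j) \<le> ennreal ((1/2) ^ j) * X"
      by (rule mult_left_mono[OF assms]) simp
    moreover have "ennreal ((1/2) ^ j) * ennreal (2 ^ j) = 1"
      by (simp add: ennreal_mult'[symmetric] power_mult_distrib[symmetric] del: ennreal_power)
    ultimately show ?thesis by (simp add: mult.assoc[symmetric])
  qed
  have "(\<Sum>j<p. e j) \<le> (\<Sum>j<p. ennreal ((1/2) ^ j) * X)" by (intro sum_mono e)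
  also have "\<dots> = ennreal (\<Sum>j<p. (1/2) ^ j) * X"
    by (simp add: sum_distrib_right[symmetric] sum_ennreal del: ennreal_power)
  also have "(\<Sum>j<p. (1/2 :: real) ^ j) = 2 - 2 * (1/2) ^ p" by (induction p) auto
  also have "ennreal (2 - 2 * (1/2) ^ p) * X \<le> ennreal 2 * X"
    by (intro mult_right_mono ennreal_leI) auto
  finally show ?thesis by simp
qed

lemma sum_lessThan_add: "(\<Sum>k<i+p. f k) = (\<Sum>k<i. f k) + (\<Sum>j<p. f (i + j) :: 'a :: comm_monoid_add)" for p :: nat
  by (induction p) (auto simp: add.assoc)

lemma locally_integrable_bounded:
  fixes f :: "real ^ 'n \<Rightarrow> real"
  assumes [measurable]: "f \<in> borel_measurable lebesgue" and "\<And>x. \<bar>f x\<bar> \<le> B"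
  shows "locally_integrable f"
  unfolding locally_integrable_def
proof (intro allI impI)
  fix K :: "(real ^ 'n) set" assume "compact K"
  then have K: "K \<in> fmeasurable lebesgue" by (rule lmeasurable_compact)
  then have [measurable]: "K \<in> sets lebesgue" by (rule fmeasurableD)
  show "set_integrable lebesgue K f"
    unfolding set_integrable_def
  proof (rule Bochner_Integration.integrable_bound)
    show "integrable lebesgue (\<lambda>x. B * indicator K x)" using K by (simp add: fmeasurable_def)
    show "AE x in lebesgue. norm (indicator K x *\<^sub>R f x) \<le> norm (B * indicator K x)"
      using assms(2) by (auto split: split_indicator intro!: AE_I2 order.trans[OF assms(2)])
  qed measurable
qed

section \<open>The maximal integral is controlled by the oscillation\<close>

text \<open>If the parts of \<open>R\<close> in the successive sets decay geometrically from the first set on that fails to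
  contain \<open>R\<close>, then on \<open>R\<close> the staircase function equals the index of that set plus a function with
  mean at most \<open>2 D\<close>. The bound is uniform in the number of steps, and since each staircase
  is bounded, integrability is never an issue.\<close>

lemma BMO_norm_staircase:
  fixes U :: "nat \<Rightarrow> (real ^ 'n) set"
  assumes [measurable]: "\<And>k. U k \<in> sets lebesgue"
    and decay: "\<And>R i j. R \<in> cubes \<Longrightarrow> \<not> R \<subseteq> U i \<Longrightarrow>
      ennreal (2 ^ j) * emeasure lebesgue (R \<inter> U (i + j)) \<le> D * emeasure lebesgue R"
  shows "locally_integrable (\<lambda>x. \<Sum>k<m. indicator (U k) x)"
    and "BMO_norm (\<lambda>x. \<Sum>k<m. indicator (U k) x) \<le> 4 * D"
proof -
  let ?b = "\<lambda>x. \<Sum>k<m. indicator (U k) x :: real"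
  show li: "locally_integrable ?b"
  proof (rule locally_integrable_bounded)
    show "\<bar>?b x\<bar> \<le> real m" for x
    proof -
      have "?b x \<le> (\<Sum>k<m. 1)" by (intro sum_mono) (auto split: split_indicator)
      moreover have "0 \<le> ?b x" by (intro sum_nonneg) auto
      ultimately show ?thesis by simp
    qed
  qed measurable
  show "BMO_norm ?b \<le> 4 * D"
  proof (rule BMO_norm_le[OF li])
    fix R :: "(real ^ 'n) set" assume R: "R \<in> cubes"
    then have [measurable]: "R \<in> sets lebesgue" by simp
    \<comment> \<open>The alternative \<open>k = m\<close> covers the case that all \<open>m\<close> sets contain \<open>R\<close>.\<close>
    define i where "i = (LEAST k. k = m \<or> \<not> R \<subseteq> U k)"
    have i: "i = m \<or> \<not> R \<subseteq> U i" unfolding i_def by (rule LeastI[of _ m]) simp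
    have "i \<le> m" unfolding i_def by (rule Least_le) simp
    then obtain p where p: "m = i + p" using le_Suc_ex by blast
    have below: "R \<subseteq> U k" if "k < i" for k
      using not_less_Least[of k "\<lambda>k. k = m \<or> \<not> R \<subseteq> U k"] that unfolding i_def by blast
    have bi: "?b x - real i = (\<Sum>j<p. indicator (U (i + j)) x)" if "x \<in> R" for x
    proof -
      have "(\<Sum>k<i. indicator (U k) x :: real) = (\<Sum>k<i. 1)"
        using below that by (intro sum.cong) (auto split: split_indicator)
      then show ?thesis unfolding p sum_lessThan_add by simp
    qed
    have "(\<integral>\<^sup>+x\<in>R. ennreal \<bar>?b x - real i\<bar> \<partial>lebesgue) = (\<integral>\<^sup>+x. (\<Sum>j<p. indicator (R \<inter> U (i + j)) x) \<partial>lebesgue)"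
    proof (intro nn_integral_cong)
      fix x
      show "ennreal \<bar>?b x - real i\<bar> * indicator R x = (\<Sum>j<p. indicator (R \<inter> U (i + j)) x)"
      proof (cases "x \<in> R")
        case True
        have "ennreal (\<Sum>j<p. indicator (U (i + j)) x) = (\<Sum>j<p. ennreal (indicator (U (i + j)) x))"
          by (rule sum_ennreal[symmetric]) simp
        then show ?thesis using True
          by (simp add: bi sum_nonneg indicator_inter_arith ennreal_indicator)
      qed simp
    qed
    also have "\<dots> = (\<Sum>j<p. emeasure lebesgue (R \<inter> U (i + j)))"
      by (subst nn_integral_sum) auto
    also have "\<dots> \<le> 2 * (D * emeasure lebesgue R)"
    proof (cases "i = m")
      case True
      then show ?thesis using p by simp
    next
      case False
      then show ?thesis using i decay[OF R] by (intro sum_geometric_decay_le) auto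
    qed
    finally have "2 * (\<integral>\<^sup>+x\<in>R. ennreal \<bar>?b x - real i\<bar> \<partial>lebesgue) \<le> 2 * (2 * (D * emeasure lebesgue R))"
      by (rule mult_left_mono) simp
    also have "2 * (2 * (D * emeasure lebesgue R)) = 4 * D * emeasure lebesgue R"
      by (simp add: mult.assoc[symmetric])
    finally show "\<exists>c. 2 * (\<integral>\<^sup>+x\<in>R. ennreal \<bar>?b x - c\<bar> \<partial>lebesgue) \<le> 4 * D * emeasure lebesgue R"
      by blast
  qed
qed

text \<open>The test function is the indicator of a corner of \<open>Q\<close> with half its side. It differs from
  its mean \<open>2\<^sup>-\<^sup>n\<close> by at least \<open>2\<^sup>-\<^sup>n\<close> at every point of \<open>Q\<close>, whatever the weight.\<close>

lemma weighted_oscillation_lower_bound: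
  fixes w :: "real ^ 'n \<Rightarrow> real"
  assumes w: "is_weight w" and Q: "Q \<in> cubes" and pos: "weight_of w Q > 0"
  shows "1 \<le> 2 ^ CARD('n) * weighted_oscillation w"
proof -
  have [measurable]: "w \<in> borel_measurable lebesgue" "Q \<in> sets lebesgue"
    using weight_measurable[OF w] Q by auto
  obtain a l where al: "l > 0" "Q = cube a l" using Q cubes_iff by blast
  define S where "S = cube a (l / 2)"
  let ?b = "indicator S :: real ^ 'n \<Rightarrow> real"
  have [measurable]: "S \<in> sets lebesgue" by (simp add: S_def)
  have sub: "S \<subseteq> Q" unfolding S_def al
  proof
    fix x assume x: "x \<in> cube a (l / 2)"
    show "x \<in> cube a l" unfolding mem_cube
    proof
      fix i show "a $ i \<le> x $ i \<and> x $ i \<le> a $ i + l"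
        using x[unfolded mem_cube, rule_format, of i] al(1) by simp
    qed
  qed
  let ?h = "(1/2 :: real) ^ CARD('n)"
  have h: "?h \<le> 1/2"
    using power_decreasing[of 1 "CARD('n)" "1/2 :: real"] by (simp add: Suc_leI)
  have li: "locally_integrable ?b"
    by (rule locally_integrable_bounded[of _ 1]) (auto split: split_indicator)
  have "BMO_norm ?b \<le> 1"
  proof (rule BMO_norm_le[OF li])
    fix R :: "(real ^ 'n) set" assume R: "R \<in> cubes"
    have "(\<integral>\<^sup>+x\<in>R. ennreal \<bar>?b x - 1/2\<bar> \<partial>lebesgue) = (\<integral>\<^sup>+x. ennreal (1/2) * indicator R x \<partial>lebesgue)"
      by (intro nn_integral_cong) (auto split: split_indicator)
    also have "\<dots> = ennreal (1/2) * emeasure lebesgue R"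
      using R by (subst nn_integral_cmult_indicator) auto
    finally have "2 * (\<integral>\<^sup>+x\<in>R. ennreal \<bar>?b x - 1/2\<bar> \<partial>lebesgue) = (ennreal 2 * ennreal (1/2)) * emeasure lebesgue R"
      by (simp add: mult.assoc)
    also have "ennreal 2 * ennreal (1/2) = 1" by (subst ennreal_mult'[symmetric]) auto
    finally show "\<exists>c. 2 * (\<integral>\<^sup>+x\<in>R. ennreal \<bar>?b x - c\<bar> \<partial>lebesgue) \<le> 1 * emeasure lebesgue R"
      by (intro exI[of _ "1/2"]) simp
  qed
  have "average ?b Q = ?h"
  proof -
    have "(LINT x:Q|lebesgue. ?b x) = measure lebesgue (S \<inter> Q)"
    proof -
      have "(\<lambda>x. indicator Q x *\<^sub>R ?b x) = indicator (S \<inter> Q)"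
        by (auto split: split_indicator)
      then show ?thesis unfolding set_lebesgue_integral_def by simp
    qed
    also have "S \<inter> Q = S" using sub by blast
    also have "measure lebesgue S = (l / 2) ^ CARD('n)"
      using al(1) unfolding S_def measure_def by (simp add: emeasure_cube)
    finally show ?thesis
    proof -
      have "measure lebesgue Q = l ^ CARD('n)"
        using al(1) unfolding al(2) measure_def by (simp add: emeasure_cube)
      moreover assume "(LINT x:Q|lebesgue. ?b x) = (l / 2) ^ CARD('n)"
      ultimately show ?thesis using al(1) unfolding average_def by (simp add: power_divide)
    qed
  qed
  then have big: "?h \<le> \<bar>?b x - average ?b Q\<bar>" for x
    using h by (simp add: indicator_def)
  have "ennreal ?h * weight_of w Q = (\<integral>\<^sup>+x. ennreal ?h * (ennreal (w x) * indicator Q x) \<partial>lebesgue)"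
    unfolding weight_of_def by (rule nn_integral_cmult[symmetric]) measurable
  also have "\<dots> \<le> (\<integral>\<^sup>+x\<in>Q. ennreal (\<bar>?b x - average ?b Q\<bar> * w x) \<partial>lebesgue)"
  proof (intro nn_integral_mono)
    fix x
    have "?h * w x \<le> \<bar>?b x - average ?b Q\<bar> * w x"
      using big w by (intro mult_right_mono) (auto simp: is_weight_def)
    then show "ennreal ?h * (ennreal (w x) * indicator Q x) \<le> ennreal (\<bar>?b x - average ?b Q\<bar> * w x) * indicator Q x"
      by (auto split: split_indicator simp: ennreal_mult'[symmetric] intro!: ennreal_leI simp del: ennreal_power)
  qed
  also have "\<dots> \<le> BMO_norm ?b * weighted_oscillation w * weight_of w Q"
    using \<open>BMO_norm ?b \<le> 1\<close> by (intro weighted_oscillation_homogeneous w li Q pos) (auto intro: le_less_trans)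
  also have "\<dots> \<le> 1 * weighted_oscillation w * weight_of w Q"
    using \<open>BMO_norm ?b \<le> 1\<close> by (intro mult_right_mono) auto
  finally have "weight_of w Q * ennreal ?h \<le> weight_of w Q * weighted_oscillation w"
    by (simp add: mult.commute)
  then have "ennreal ?h \<le> weighted_oscillation w"
    using pos weight_of_finite[OF w Q] by (subst (asm) ennreal_mult_le_mult_iff) auto
  then have "ennreal (2 ^ CARD('n)) * ennreal ?h \<le> ennreal (2 ^ CARD('n)) * weighted_oscillation w"
    by (rule mult_left_mono) simp
  also have "ennreal (2 ^ CARD('n)) * ennreal ?h = 1"
    by (subst ennreal_mult'[symmetric]) (auto simp: power_mult_distrib[symmetric])
  finally show ?thesis by (simp add: ennreal_power[symmetric])
qed

text \<open>A discrete layer-cake formula: between two consecutive layers the maximal function is at most the upper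
  level.\<close>

lemma maximal_le_dyadic_layers:
  assumes lam: "lam > 0"
  shows "maximal g x \<le> ennreal lam +
    (\<Sum>k. ennreal (2 ^ Suc k * lam) * indicator {x. ennreal (2 ^ k * lam) < maximal g x} x)"
    (is "_ \<le> ennreal lam + (\<Sum>k. ?f k)")
proof (rule dense_le)
  fix y assume y: "y < maximal g x"
  then have "y < top" using less_le_trans top_greatest by blast
  then obtain r where r: "0 \<le> r" "y = ennreal r" using less_top_ennreal by auto
  have f: "?f k \<le> (\<Sum>k. ?f k)" for k
  proof -
    have "F k \<le> (\<Sum>k. F k)" for F :: "nat \<Rightarrow> ennreal"
      using sum_le_suminf[OF summableI, of "{k}" F] by simp
    then show ?thesis .
  qed
  \<comment> \<open>Working with finite \<open>y\<close> below the maximal function covers points where it is infinite.\<close>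
  have key: "y \<le> ennreal (2 ^ k * lam) \<Longrightarrow> y \<le> ennreal lam + (\<Sum>k. ?f k)" for k
  proof (induction k)
    case 0
    then show ?case by (simp add: add_increasing2)
  next
    case (Suc k)
    show ?case
    proof (cases "y \<le> ennreal (2 ^ k * lam)")
      case True
      then show ?thesis by (rule Suc.IH)
    next
      case False
      then have "ennreal (2 ^ k * lam) < maximal g x" using y by (meson less_trans not_le)
      then have "y \<le> ?f k" using Suc.prems by simp
      also have "\<dots> \<le> (\<Sum>k. ?f k)" by (rule f)
      finally show ?thesis by (simp add: add_increasing)
    qed
  qed
  obtain k where "r / lam < 2 ^ k" using real_arch_pow[of 2 "r / lam"] by auto
  then have "r \<le> 2 ^ k * lam" using lam by (simp add: field_simps)
  then show "y \<le> ennreal lam + (\<Sum>k. ?f k)" by (intro key[of k]) (simp add: r ennreal_leI)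
qed

text \<open>With \<open>f = w \<chi>\<^sub>Q\<close> and \<open>\<lambda> = w(Q)/|Q|\<close>, the layers \<open>U\<^sub>k = {M f > 2\<^sup>k \<lambda>}\<close> have weighted measure
  at least \<open>3\<^sup>-\<^sup>n 2\<^sup>k \<lambda> |U\<^sub>k|\<close>, so up to \<open>w(Q)\<close> the integral of \<open>M f\<close> is controlled by
  \<open>\<Sum>\<^sub>k w(U\<^sub>k \<inter> Q)\<close>, which is the integral of \<open>b w\<close> over \<open>Q\<close> for the staircase function
  \<open>b = \<Sum>\<^sub>k \<chi>(U\<^sub>k)\<close> (taken up to a finite index), a discrete version of the positive part of \<open>log (M f / \<lambda>)\<close>. Now \<open>b\<close> has bounded
  BMO norm by the weak \<open>A\<^sub>1\<close> property, and its mean over \<open>Q\<close> is bounded by the weak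
  type inequality, since the average of \<open>f\<close> over \<open>Q\<close> is \<open>\<lambda>\<close>.\<close>

lemma maximal_integral_le_oscillation:
  fixes w :: "real ^ 'n \<Rightarrow> real"
  assumes w: "is_weight w" and Q: "Q \<in> cubes" and pos: "weight_of w Q > 0"
  shows "(\<integral>\<^sup>+x\<in>Q. maximal (\<lambda>y. w y * indicator Q y) x \<partial>lebesgue)
    \<le> weight_of w Q + 2 * 3 ^ CARD('n) *
        ((4 * 9 ^ CARD('n) * weighted_oscillation w + 2 * 3 ^ CARD('n)) * weight_of w Q)"
proof (cases "weighted_oscillation w = top")
  case True
  then show ?thesis using pos by (simp add: ennreal_mult_top ennreal_top_mult)
next
  case False
  have [measurable]: "w \<in> borel_measurable lebesgue" "Q \<in> sets lebesgue"
    using weight_measurable[OF w] Q by auto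
  have w0: "0 \<le> w x" for x using w by (simp add: is_weight_def)
  define f where "f y = w y * indicator Q y" for y
  have [measurable]: "f \<in> borel_measurable lebesgue" unfolding f_def by measurable
  define v where "v = measure lebesgue Q"
  have v: "v > 0" "emeasure lebesgue Q = ennreal v"
    unfolding v_def using emeasure_cubes(1,2)[OF Q] by auto
  obtain W where W: "0 \<le> W" "weight_of w Q = ennreal W"
    using weight_of_finite[OF w Q] less_top_ennreal by auto
  have Wp: "W > 0" using pos W by simp
  define lam where "lam = W / v"
  have lam: "lam > 0" "lam * v = W" unfolding lam_def using v Wp by auto
  define U where "U k = {x. ennreal (2 ^ k * lam) < maximal f x}" for k :: nat
  have Um [measurable]: "U k \<in> sets lebesgue" for k
    unfolding U_def using open_superlevel_maximal[of "2 ^ k * lam" f] lam by simp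
  have decay: "ennreal (2 ^ j) * emeasure lebesgue (R \<inter> U (i + j)) \<le> 9 ^ CARD('n) * emeasure lebesgue R"
    if R: "R \<in> cubes" "\<not> R \<subseteq> U i" for R i j
  proof -
    obtain y where y: "y \<in> R" "maximal f y \<le> ennreal (2 ^ i * lam)"
      using R(2) unfolding U_def subset_iff mem_Collect_eq not_le[symmetric] by blast
    have "ennreal (2 ^ i * lam) * (ennreal (2 ^ j) * emeasure lebesgue (R \<inter> U (i + j)))
        = ennreal (2 ^ (i + j) * lam) * emeasure lebesgue (R \<inter> U (i + j))"
    proof -
      have "ennreal (2 ^ (i + j) * lam) = ennreal (2 ^ i * lam) * ennreal (2 ^ j)"
        using lam by (subst ennreal_mult'[symmetric]) (simp_all add: power_add mult_ac)
      then show ?thesis by (simp only: mult.assoc)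
    qed
    also have "\<dots> \<le> 9 ^ CARD('n) * (maximal f y * emeasure lebesgue R)"
      unfolding U_def using lam by (intro maximal_weak_A1 R(1) y(1)) auto
    also have "\<dots> \<le> 9 ^ CARD('n) * (ennreal (2 ^ i * lam) * emeasure lebesgue R)"
      by (intro mult_left_mono mult_right_mono y(2)) auto
    finally have "ennreal (2 ^ i * lam) * (ennreal (2 ^ j) * emeasure lebesgue (R \<inter> U (i + j)))
        \<le> ennreal (2 ^ i * lam) * (9 ^ CARD('n) * emeasure lebesgue R)"
      by (simp add: mult_ac)
    then show ?thesis using lam by (subst (asm) ennreal_mult_le_mult_iff) auto
  qed
  have size: "ennreal (2 ^ k) * emeasure lebesgue (Q \<inter> U k) \<le> 3 ^ CARD('n) * emeasure lebesgue Q" for k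
  proof -
    have "ennreal lam * (ennreal (2 ^ k) * emeasure lebesgue (Q \<inter> U k))
        = ennreal (2 ^ k * lam) * emeasure lebesgue (Q \<inter> U k)"
    proof -
      have "ennreal (2 ^ k * lam) = ennreal lam * ennreal (2 ^ k)"
        using lam by (subst ennreal_mult'[symmetric]) (simp_all add: mult_ac)
      then show ?thesis by (simp only: mult.assoc)
    qed
    also have "\<dots> \<le> ennreal (2 ^ k * lam) * emeasure lebesgue (U k)"
      by (intro mult_left_mono emeasure_mono) auto
    also have "\<dots> \<le> 3 ^ CARD('n) * (\<integral>\<^sup>+x\<in>U k. ennreal \<bar>f x\<bar> \<partial>lebesgue)"
      unfolding U_def using lam by (intro maximal_weak_type) auto
    also have "\<dots> \<le> 3 ^ CARD('n) * weight_of w Q"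
      unfolding weight_of_def f_def using w0
      by (intro mult_left_mono nn_integral_mono) (auto split: split_indicator)
    also have "\<dots> = ennreal lam * (3 ^ CARD('n) * emeasure lebesgue Q)"
      using lam v by (simp add: W(2) lam(2)[symmetric] ennreal_mult' mult_ac)
    finally show ?thesis using lam by (subst (asm) ennreal_mult_le_mult_iff) auto
  qed
  have layers: "(\<Sum>k<m. \<integral>\<^sup>+x\<in>U k. ennreal \<bar>f x\<bar> \<partial>lebesgue)
      \<le> (4 * 9 ^ CARD('n) * weighted_oscillation w + 2 * 3 ^ CARD('n)) * weight_of w Q" for m
  proof -
    let ?b = "\<lambda>x. \<Sum>k<m. indicator (U k) x :: real"
    have li: "locally_integrable ?b" and bmo: "BMO_norm ?b \<le> 4 * 9 ^ CARD('n)"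
      by (rule BMO_norm_staircase(1)[OF Um decay], assumption+)
        (rule BMO_norm_staircase(2)[OF Um decay], assumption+)
    have bfin: "BMO_norm ?b < top"
      by (rule le_less_trans[OF bmo]) (simp add: ennreal_mult_less_top power_less_top_ennreal)
    have [measurable]: "?b \<in> borel_measurable lebesgue" by measurable
    have b0: "?b x \<ge> 0" for x by (intro sum_nonneg) auto
    have bsum: "ennreal (?b x) = (\<Sum>k<m. indicator (U k) x)" for x
      by (subst sum_ennreal[symmetric]) (auto simp: ennreal_indicator)
    have "ennreal \<bar>average ?b Q\<bar> * emeasure lebesgue Q \<le> (\<integral>\<^sup>+x\<in>Q. ennreal (?b x) \<partial>lebesgue)"
      using average_diff_le[OF li Q, of 0] b0 by simp
    also have "\<dots> = (\<integral>\<^sup>+x. (\<Sum>k<m. indicator (Q \<inter> U k) x) \<partial>lebesgue)"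
      unfolding bsum
      by (intro nn_integral_cong) (simp only: indicator_inter_arith sum_distrib_left[symmetric] mult.commute)
    also have "\<dots> = (\<Sum>k<m. emeasure lebesgue (Q \<inter> U k))"
      by (subst nn_integral_sum) auto
    also have "\<dots> \<le> 2 * (3 ^ CARD('n) * emeasure lebesgue Q)"
      by (rule sum_geometric_decay_le[OF size])
    finally have "emeasure lebesgue Q * ennreal \<bar>average ?b Q\<bar> \<le> emeasure lebesgue Q * (2 * 3 ^ CARD('n))"
      by (simp add: mult_ac)
    then have av: "ennreal \<bar>average ?b Q\<bar> \<le> 2 * 3 ^ CARD('n)"
      using emeasure_cubes(3,4)[OF Q] by (subst (asm) ennreal_mult_le_mult_iff) auto
    have "(\<Sum>k<m. \<integral>\<^sup>+x\<in>U k. ennreal \<bar>f x\<bar> \<partial>lebesgue)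
        = (\<integral>\<^sup>+x. (\<Sum>k<m. ennreal \<bar>f x\<bar> * indicator (U k) x) \<partial>lebesgue)"
      by (subst nn_integral_sum) auto
    also have "\<dots> \<le> (\<integral>\<^sup>+x. ennreal (\<bar>?b x - average ?b Q\<bar> * w x) * indicator Q x
        + ennreal \<bar>average ?b Q\<bar> * (ennreal (w x) * indicator Q x) \<partial>lebesgue)"
    proof (intro nn_integral_mono)
      fix x
      show "(\<Sum>k<m. ennreal \<bar>f x\<bar> * indicator (U k) x)
        \<le> ennreal (\<bar>?b x - average ?b Q\<bar> * w x) * indicator Q x
          + ennreal \<bar>average ?b Q\<bar> * (ennreal (w x) * indicator Q x)"
      proof (cases "x \<in> Q")
        case True
        have "?b x \<le> \<bar>?b x - average ?b Q\<bar> + \<bar>average ?b Q\<bar>" by linarith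
        from mult_right_mono[OF this w0[of x]]
        have "?b x * w x \<le> \<bar>?b x - average ?b Q\<bar> * w x + \<bar>average ?b Q\<bar> * w x"
          by (simp only: distrib_right)
        then have "ennreal (?b x * w x) \<le> ennreal (\<bar>?b x - average ?b Q\<bar> * w x) + ennreal (\<bar>average ?b Q\<bar> * w x)"
          by (subst ennreal_plus[symmetric]) (simp_all add: w0 ennreal_leI del: ennreal_plus)
        moreover have "(\<Sum>k<m. ennreal \<bar>f x\<bar> * indicator (U k) x) = ennreal (?b x * w x)"
          using True w0[of x] b0[of x]
          by (simp only: ennreal_mult'' bsum sum_distrib_left[symmetric])
            (simp add: f_def mult.commute)
        ultimately show ?thesis using True w0 by (simp add: ennreal_mult')
      qed (simp add: f_def)
    qed
    also have "\<dots> = (\<integral>\<^sup>+x\<in>Q. ennreal (\<bar>?b x - average ?b Q\<bar> * w x) \<partial>lebesgue)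
        + ennreal \<bar>average ?b Q\<bar> * weight_of w Q"
      unfolding weight_of_def
      by (subst nn_integral_add, measurable, subst nn_integral_cmult, measurable)
    also have "\<dots> \<le> BMO_norm ?b * weighted_oscillation w * weight_of w Q + (2 * 3 ^ CARD('n)) * weight_of w Q"
      using bfin by (intro add_mono weighted_oscillation_homogeneous mult_right_mono av w li Q pos) auto
    also have "\<dots> \<le> 4 * 9 ^ CARD('n) * weighted_oscillation w * weight_of w Q + (2 * 3 ^ CARD('n)) * weight_of w Q"
      using bmo by (intro add_mono mult_right_mono) auto
    finally show ?thesis by (simp add: distrib_right)
  qed
  have "(\<integral>\<^sup>+x\<in>Q. maximal f x \<partial>lebesgue)
      \<le> (\<integral>\<^sup>+x. ennreal lam * indicator Q x + (\<Sum>k. ennreal (2 ^ Suc k * lam) * indicator (U k) x) \<partial>lebesgue)"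
  proof (intro nn_integral_mono)
    fix x
    show "maximal f x * indicator Q x
      \<le> ennreal lam * indicator Q x + (\<Sum>k. ennreal (2 ^ Suc k * lam) * indicator (U k) x)"
      using maximal_le_dyadic_layers[OF lam(1), of f x] unfolding U_def
      by (cases "x \<in> Q") auto
  qed
  also have "\<dots> = ennreal lam * emeasure lebesgue Q
      + (\<Sum>k. ennreal (2 ^ Suc k * lam) * emeasure lebesgue (U k))"
    by (subst nn_integral_add, measurable, subst nn_integral_suminf, measurable)
      (simp add: nn_integral_cmult_indicator)
  also have "ennreal lam * emeasure lebesgue Q = weight_of w Q"
    using lam v by (simp add: W(2) ennreal_mult'[symmetric])
  also have "(\<Sum>k. ennreal (2 ^ Suc k * lam) * emeasure lebesgue (U k))
      \<le> 2 * 3 ^ CARD('n) * ((4 * 9 ^ CARD('n) * weighted_oscillation w + 2 * 3 ^ CARD('n)) * weight_of w Q)"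
  proof (rule suminf_le_const[OF summableI])
    fix m
    have "ennreal (2 ^ Suc k * lam) * emeasure lebesgue (U k)
        \<le> 2 * 3 ^ CARD('n) * (\<integral>\<^sup>+x\<in>U k. ennreal \<bar>f x\<bar> \<partial>lebesgue)" for k
    proof -
      have "ennreal (2 ^ k * lam) * emeasure lebesgue (U k) \<le> 3 ^ CARD('n) * (\<integral>\<^sup>+x\<in>U k. ennreal \<bar>f x\<bar> \<partial>lebesgue)"
        unfolding U_def using lam by (intro maximal_weak_type) auto
      from mult_left_mono[OF this, of "ennreal 2"] show ?thesis
        by (simp add: mult.assoc[symmetric] ennreal_mult'[symmetric] del: ennreal_numeral) simp
    qed
    then have "(\<Sum>k<m. ennreal (2 ^ Suc k * lam) * emeasure lebesgue (U k))
        \<le> (\<Sum>k<m. 2 * 3 ^ CARD('n) * (\<integral>\<^sup>+x\<in>U k. ennreal \<bar>f x\<bar> \<partial>lebesgue))"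
      by (intro sum_mono)
    also have "\<dots> = 2 * 3 ^ CARD('n) * (\<Sum>k<m. \<integral>\<^sup>+x\<in>U k. ennreal \<bar>f x\<bar> \<partial>lebesgue)"
      by (rule sum_distrib_left[symmetric])
    also have "\<dots> \<le> 2 * 3 ^ CARD('n) * ((4 * 9 ^ CARD('n) * weighted_oscillation w + 2 * 3 ^ CARD('n)) * weight_of w Q)"
      by (intro mult_left_mono layers) simp
    finally show "(\<Sum>k<m. ennreal (2 ^ Suc k * lam) * emeasure lebesgue (U k))
      \<le> 2 * 3 ^ CARD('n) * ((4 * 9 ^ CARD('n) * weighted_oscillation w + 2 * 3 ^ CARD('n)) * weight_of w Q)" .
  qed
  finally show ?thesis unfolding f_def by (simp add: add_left_mono)
qed

lemma A_infinity_le_weighted_oscillation: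
  fixes w :: "real ^ 'n \<Rightarrow> real"
  assumes w: "is_weight w"
  shows "A_infinity w \<le> (2 ^ CARD('n) + 2 * 3 ^ CARD('n) * (4 * 9 ^ CARD('n) + 2 * 3 ^ CARD('n) * 2 ^ CARD('n)))
    * weighted_oscillation w"
  unfolding A_infinity_def
proof (rule SUP_least)
  fix Q :: "(real ^ 'n) set" assume "Q \<in> {Q \<in> cubes. weight_of w Q > 0}"
  then have Q: "Q \<in> cubes" "weight_of w Q > 0" by auto
  let ?X = "weighted_oscillation w" and ?W = "weight_of w Q"
  let ?C = "2 ^ CARD('n) + 2 * 3 ^ CARD('n) * (4 * 9 ^ CARD('n) + 2 * 3 ^ CARD('n) * 2 ^ CARD('n)) :: ennreal"
  have one: "1 \<le> 2 ^ CARD('n) * ?X" by (rule weighted_oscillation_lower_bound[OF w Q])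
  have "(\<integral>\<^sup>+x\<in>Q. maximal (\<lambda>y. w y * indicator Q y) x \<partial>lebesgue)
    \<le> 1 * ?W + 2 * 3 ^ CARD('n) * ((4 * 9 ^ CARD('n) * ?X + 2 * 3 ^ CARD('n) * 1) * ?W)"
    using maximal_integral_le_oscillation[OF w Q] by simp
  also have "\<dots> \<le> (2 ^ CARD('n) * ?X) * ?W + 2 * 3 ^ CARD('n) *
      ((4 * 9 ^ CARD('n) * ?X + 2 * 3 ^ CARD('n) * (2 ^ CARD('n) * ?X)) * ?W)"
    using one by (intro add_mono mult_left_mono mult_right_mono order.refl) auto
  also have "\<dots> = ?C * ?X * ?W"
    by (simp add: algebra_simps)
  finally have "(\<integral>\<^sup>+x\<in>Q. maximal (\<lambda>y. w y * indicator Q y) x \<partial>lebesgue) / ?W \<le> ?C * ?X * ?W / ?W"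
    by (rule divide_right_mono_ennreal)
  also have "\<dots> = ?C * ?X"
    using Q weight_of_finite[OF w Q(1)] by (intro mult_divide_eq_ennreal) auto
  finally show "(\<integral>\<^sup>+x\<in>Q. maximal (\<lambda>y. w y * indicator Q y) x \<partial>lebesgue) / ?W \<le> ?C * ?X" .
qed

section \<open>Dyadic stopping cubes\<close>

text \<open>The dyadic subcubes of half the side, indexed by the set of coordinates in which they are shifted.\<close>

definition child :: "real ^ 'n \<Rightarrow> real \<Rightarrow> 'n set \<Rightarrow> (real ^ 'n) set" where
  "child a l s = cube (a + (\<chi> i. if i \<in> s then l / 2 else 0)) (l / 2)"

lemma sets_child [measurable, simp]: "child a l s \<in> sets lebesgue"
  by (simp add: child_def)

lemma child_subset: "l > 0 \<Longrightarrow> child a l s \<subseteq> cube a l"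
proof
  fix x assume "l > 0" and x: "x \<in> child a l s"
  show "x \<in> cube a l" unfolding mem_cube
  proof
    fix i show "a $ i \<le> x $ i \<and> x $ i \<le> a $ i + l"
      using x[unfolded child_def mem_cube, rule_format, of i] \<open>l > 0\<close> by (simp split: if_splits)
  qed
qed

lemma emeasure_child:
  fixes a :: "real ^ 'n"
  assumes "l > 0"
  shows "emeasure lebesgue (cube a l) = 2 ^ CARD('n) * emeasure lebesgue (child a l s)"
proof -
  have "l ^ CARD('n) = 2 ^ CARD('n) * (l / 2) ^ CARD('n)" by (simp add: power_divide)
  then have "ennreal (l ^ CARD('n)) = ennreal (2 ^ CARD('n)) * ennreal ((l / 2) ^ CARD('n))"
    using assms by (simp only: ennreal_mult[of "2 ^ CARD('n)" "(l / 2) ^ CARD('n)"] zero_le_power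
        zero_le_numeral less_imp_le half_gt_zero)
  then show ?thesis
    using assms by (simp add: child_def emeasure_cube ennreal_power[symmetric] del: ennreal_power)
qed

text \<open>The closed subcubes overlap on hyperplanes; away from these the index of the subcube that contains
  \<open>x\<close> is determined by \<open>x\<close>.\<close>

lemma AE_children:
  fixes a :: "real ^ 'n"
  assumes "l > 0"
  shows "AE x in lebesgue. (\<Sum>s\<in>UNIV. indicator (child a l s) x) = (indicator (cube a l) x :: ennreal)"
proof -
  have "negligible {x. x $ i = a $ i + l / 2}" for i
    using negligible_standard_hyperplane[of "axis i (1::real)" "a $ i + l / 2"] by (simp add: inner_axis axis_in_Basis_iff)
  then have "negligible (\<Union>i::'n. {x. x $ i = a $ i + l / 2})"
    by (intro negligible_Union) auto
  then have "AE x in lebesgue. x \<notin> (\<Union>i::'n. {x. x $ i = a $ i + l / 2})"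
    by (intro AE_not_in) (simp only: negligible_iff_null_sets)
  then show ?thesis
  proof eventually_elim
    case (elim x)
    show ?case
    proof (cases "x \<in> cube a l")
      case True
      have "x \<in> child a l s \<longleftrightarrow> s = {i. x $ i > a $ i + l / 2}" for s
      proof -
        have "x \<in> child a l s \<longleftrightarrow> (\<forall>i. i \<in> s \<longleftrightarrow> x $ i > a $ i + l / 2)"
          unfolding child_def mem_cube
        proof (intro iff_allI)
          fix i
          have "x $ i \<noteq> a $ i + l / 2" using elim by blast
          then show "((a + (\<chi> i. if i \<in> s then l / 2 else 0)) $ i \<le> x $ i \<and>
              x $ i \<le> (a + (\<chi> i. if i \<in> s then l / 2 else 0)) $ i + l / 2) =
              (i \<in> s \<longleftrightarrow> x $ i > a $ i + l / 2)"
            using True[unfolded mem_cube, rule_format, of i] by auto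
        qed
        then show ?thesis by blast
      qed
      then have "(\<Sum>s\<in>UNIV. indicator (child a l s) x :: ennreal)
          = (\<Sum>s\<in>UNIV. if s = {i. x $ i > a $ i + l / 2} then 1 else 0)"
        by (intro sum.cong) (auto simp: indicator_def)
      then show ?thesis using True by simp
    next
      case False
      then have "indicator (child a l s) x = (0 :: ennreal)" for s
        using child_subset[OF assms] by (auto simp: indicator_def)
      then show ?thesis using False by simp
    qed
  qed
qed

lemma nn_integral_children:
  fixes a :: "real ^ 'n"
  assumes l: "l > 0" and [measurable]: "h \<in> borel_measurable lebesgue"
  shows "(\<integral>\<^sup>+x\<in>cube a l. h x \<partial>lebesgue) = (\<Sum>s\<in>UNIV. \<integral>\<^sup>+x\<in>child a l s. h x \<partial>lebesgue)"
proof -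
  have "(\<integral>\<^sup>+x\<in>cube a l. h x \<partial>lebesgue) = (\<integral>\<^sup>+x. (\<Sum>s\<in>UNIV. h x * indicator (child a l s) x) \<partial>lebesgue)"
  proof (rule nn_integral_cong_AE)
    show "AE x in lebesgue. h x * indicator (cube a l) x = (\<Sum>s\<in>UNIV. h x * indicator (child a l s) x)"
      using AE_children[OF l, of a] by eventually_elim (simp only: sum_distrib_left[symmetric])
  qed
  also have "\<dots> = (\<Sum>s\<in>UNIV. \<integral>\<^sup>+x\<in>child a l s. h x \<partial>lebesgue)"
    by (intro nn_integral_sum) measurable
  finally show ?thesis .
qed

lemma nn_integral_UN_children_ge:
  fixes a :: "real ^ 'n"
  assumes l: "l > 0" and [measurable]: "h \<in> borel_measurable lebesgue" "\<And>s. E s \<in> sets lebesgue"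
    and E: "\<And>s. E s \<subseteq> child a l s"
  shows "(\<Sum>s\<in>UNIV. \<integral>\<^sup>+x\<in>E s. h x \<partial>lebesgue) \<le> (\<integral>\<^sup>+x\<in>(\<Union>s. E s). h x \<partial>lebesgue)"
proof -
  have "(\<Sum>s\<in>UNIV. \<integral>\<^sup>+x\<in>E s. h x \<partial>lebesgue) = (\<integral>\<^sup>+x. (\<Sum>s\<in>UNIV. h x * indicator (E s) x) \<partial>lebesgue)"
    by (intro nn_integral_sum[symmetric]) measurable
  also have "\<dots> \<le> (\<integral>\<^sup>+x\<in>(\<Union>s. E s). h x \<partial>lebesgue)"
  proof (rule nn_integral_mono_AE)
    show "AE x in lebesgue. (\<Sum>s\<in>UNIV. h x * indicator (E s) x) \<le> h x * indicator (\<Union>s. E s) x"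
      using AE_children[OF l, of a]
    proof eventually_elim
      case (elim x)
      have "(\<Sum>s\<in>UNIV. indicator (E s) x) \<le> (indicator (\<Union>s. E s) x :: ennreal)"
      proof (cases "x \<in> (\<Union>s. E s)")
        case True
        have "(\<Sum>s\<in>UNIV. indicator (E s) x) \<le> (\<Sum>s\<in>UNIV. indicator (child a l s) x :: ennreal)"
          using E by (intro sum_mono) (auto split: split_indicator)
        also have "\<dots> \<le> 1" unfolding elim by (simp split: split_indicator)
        finally show ?thesis using True by simp
      qed simp
      from mult_left_mono[OF this, of "h x"] show ?case by (simp add: sum_distrib_left)
    qed
  qed
  finally show ?thesis .
qed

text \<open>The volume ratio \<open>2\<^sup>n\<close> bounds the jump of the averages between consecutive generations; it limits
  by how much a stopping cube can overshoot.\<close>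

lemma average_child_diff:
  fixes b :: "real ^ 'n \<Rightarrow> real"
  assumes b: "locally_integrable b" and bmo: "BMO_norm b \<le> 1" and l: "l > 0"
  shows "ennreal \<bar>average b (child a l s) - average b (cube a l)\<bar> \<le> 2 ^ CARD('n)"
proof -
  let ?c = "average b (cube a l)"
  have ch: "child a l s \<in> cubes" unfolding child_def using l by (intro cube_in_cubes) simp
  have "ennreal \<bar>average b (child a l s) - ?c\<bar> * emeasure lebesgue (child a l s)
      \<le> (\<integral>\<^sup>+x\<in>child a l s. ennreal \<bar>b x - ?c\<bar> \<partial>lebesgue)"
    by (rule average_diff_le[OF b ch])
  also have "\<dots> \<le> (\<integral>\<^sup>+x\<in>cube a l. ennreal \<bar>b x - ?c\<bar> \<partial>lebesgue)"
    using child_subset[OF l] by (intro nn_integral_mono) (auto split: split_indicator)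
  also have "\<dots> \<le> BMO_norm b * emeasure lebesgue (cube a l)"
    by (rule BMO_oscillation_le[OF cube_in_cubes[OF l]])
  also have "\<dots> \<le> 1 * emeasure lebesgue (cube a l)"
    using bmo by (rule mult_right_mono) simp
  also have "\<dots> = 2 ^ CARD('n) * emeasure lebesgue (child a l s)"
    by (simp add: emeasure_child[OF l, of a s])
  finally have "emeasure lebesgue (child a l s) * ennreal \<bar>average b (child a l s) - ?c\<bar>
      \<le> emeasure lebesgue (child a l s) * 2 ^ CARD('n)"
    by (simp add: mult.commute)
  then show ?thesis
    using emeasure_cubes(3,4)[OF ch] by (subst (asm) ennreal_mult_le_mult_iff) auto
qed

text \<open>The data of the stopping time argument on \<open>Q\<close>: \<open>W\<close> is a weight, \<open>G\<close> dominates its averages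
  (later \<open>G\<close> is the maximal function), and at scale \<open>\<delta>\<close> the weight is constant up
  to the error \<open>H\<close>, whose integral will be made small. The level \<open>N\<close> truncates the oscillation, so that the error is
  multiplied by a finite factor only.\<close>

locale dyadic_domination =
  fixes b :: "real ^ 'n \<Rightarrow> real" and W G H :: "real ^ 'n \<Rightarrow> ennreal"
    and Q :: "(real ^ 'n) set" and N A :: ennreal and \<delta> :: real
  assumes b: "locally_integrable b" and bmo: "BMO_norm b \<le> 1"
    and A: "A = 3 + 2 ^ CARD('n)"
    and W [measurable]: "W \<in> borel_measurable lebesgue"
    and G [measurable]: "G \<in> borel_measurable lebesgue"
    and H [measurable]: "H \<in> borel_measurable lebesgue"
    and averages_le: "\<And>R x. R \<in> cubes \<Longrightarrow> R \<subseteq> Q \<Longrightarrow> x \<in> R \<Longrightarrow>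
        (\<integral>\<^sup>+y\<in>R. W y \<partial>lebesgue) \<le> G x * emeasure lebesgue R"
    and \<delta>: "\<delta> > 0"
    and nearly_constant: "\<And>a l. 0 < l \<Longrightarrow> l \<le> \<delta> \<Longrightarrow> cube a l \<subseteq> Q \<Longrightarrow>
        \<exists>v. \<forall>x\<in>cube a l. W x \<le> v + H x \<and> v \<le> W x + H x"
begin

abbreviation osc :: "real \<Rightarrow> real ^ 'n \<Rightarrow> ennreal" where
  "osc c x \<equiv> ennreal \<bar>b x - c\<bar>"

abbreviation trunc :: "real \<Rightarrow> real ^ 'n \<Rightarrow> ennreal" where
  "trunc c x \<equiv> min (osc c x) N"

lemma b_measurable [measurable]: "b \<in> borel_measurable lebesgue"
  by (rule locally_integrable_measurable[OF b])

text \<open>Here \<open>E\<close> stands for the union of the stopping cubes inside \<open>R\<close>, those maximal dyadic subcubes on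
  which the average of \<open>b\<close> differs from \<open>c\<close> by more than 2; the bound on its measure is the Chebyshev inequality. Recording only \<open>E\<close> and
  not the family keeps the induction over generations short.\<close>

definition controlled :: "(real ^ 'n) set \<Rightarrow> real \<Rightarrow> (real ^ 'n) set \<Rightarrow> bool" where
  "controlled R c E \<longleftrightarrow> E \<in> sets lebesgue \<and> E \<subseteq> R \<and>
     2 * emeasure lebesgue E \<le> (\<integral>\<^sup>+x\<in>R. osc c x \<partial>lebesgue) \<and>
     (\<integral>\<^sup>+x\<in>R. trunc c x * W x \<partial>lebesgue)
       \<le> A * (\<integral>\<^sup>+x\<in>R. W x \<partial>lebesgue) + 2 * A * (\<integral>\<^sup>+x\<in>E. G x \<partial>lebesgue)
         + (N + 3) * (\<integral>\<^sup>+x\<in>R. H x \<partial>lebesgue)"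

lemma osc_average_le: "R \<in> cubes \<Longrightarrow> (\<integral>\<^sup>+x\<in>R. osc (average b R) x \<partial>lebesgue) \<le> emeasure lebesgue R"
  using order.trans[OF BMO_oscillation_le[of R b] mult_right_mono[OF bmo, of "emeasure lebesgue R"]] by simp

lemma osc_triangle: "osc c x \<le> ennreal \<bar>d - c\<bar> + osc d x"
  by (subst ennreal_plus[symmetric]) (auto intro!: ennreal_leI simp del: ennreal_plus)

text \<open>At the smallest scale \<open>W\<close> is essentially a constant, which may be pulled out of the integral of the
  oscillation.\<close>

lemma controlled_small:
  assumes l: "0 < l" "l \<le> \<delta>" and sub: "cube a l \<subseteq> Q"
    and c: "ennreal \<bar>average b (cube a l) - c\<bar> \<le> 2"
  shows "controlled (cube a l) c {}"
proof -
  let ?R = "cube a l"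
  have R: "?R \<in> cubes" using l by (intro cube_in_cubes) auto
  obtain v where v: "\<And>x. x \<in> ?R \<Longrightarrow> W x \<le> v + H x" "\<And>x. x \<in> ?R \<Longrightarrow> v \<le> W x + H x"
    using nearly_constant[OF l sub] by blast
  have "(\<integral>\<^sup>+x\<in>?R. osc c x \<partial>lebesgue)
      \<le> (\<integral>\<^sup>+x. osc (average b ?R) x * indicator ?R x + 2 * indicator ?R x \<partial>lebesgue)"
  proof (intro nn_integral_mono)
    fix x
    have "osc c x \<le> 2 + osc (average b ?R) x"
      using osc_triangle[of x c "average b ?R"] c by (meson add_right_mono order.trans)
    then show "osc c x * indicator ?R x \<le> osc (average b ?R) x * indicator ?R x + 2 * indicator ?R x"
      by (simp add: add.commute split: split_indicator)
  qed
  also have "\<dots> = (\<integral>\<^sup>+x\<in>?R. osc (average b ?R) x \<partial>lebesgue) + 2 * emeasure lebesgue ?R"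
    by (subst nn_integral_add) (auto simp: nn_integral_cmult_indicator)
  also have "\<dots> \<le> emeasure lebesgue ?R + 2 * emeasure lebesgue ?R"
    by (intro add_right_mono osc_average_le R)
  also have "\<dots> = 3 * emeasure lebesgue ?R"
  proof -
    have "1 * emeasure lebesgue ?R + 2 * emeasure lebesgue ?R = (1 + 2) * emeasure lebesgue ?R"
      by (simp only: distrib_right)
    then show ?thesis by simp
  qed
  finally have osc3: "(\<integral>\<^sup>+x\<in>?R. osc c x \<partial>lebesgue) \<le> 3 * emeasure lebesgue ?R" .
  have "v * emeasure lebesgue ?R = (\<integral>\<^sup>+x. v * indicator ?R x \<partial>lebesgue)"
    by (simp add: nn_integral_cmult_indicator)
  also have "\<dots> \<le> (\<integral>\<^sup>+x. W x * indicator ?R x + H x * indicator ?R x \<partial>lebesgue)"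
    using v(2) by (intro nn_integral_mono) (auto split: split_indicator)
  also have "\<dots> = (\<integral>\<^sup>+x\<in>?R. W x \<partial>lebesgue) + (\<integral>\<^sup>+x\<in>?R. H x \<partial>lebesgue)"
    by (subst nn_integral_add) auto
  finally have vR: "v * emeasure lebesgue ?R \<le> (\<integral>\<^sup>+x\<in>?R. W x \<partial>lebesgue) + (\<integral>\<^sup>+x\<in>?R. H x \<partial>lebesgue)" .
  have "(\<integral>\<^sup>+x\<in>?R. trunc c x * W x \<partial>lebesgue)
      \<le> (\<integral>\<^sup>+x. v * (osc c x * indicator ?R x) + N * (H x * indicator ?R x) \<partial>lebesgue)"
  proof (intro nn_integral_mono)
    fix x
    show "trunc c x * W x * indicator ?R x \<le> v * (osc c x * indicator ?R x) + N * (H x * indicator ?R x)"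
    proof (cases "x \<in> ?R")
      case True
      have "trunc c x * W x \<le> trunc c x * (v + H x)" by (intro mult_left_mono v True) simp
      also have "\<dots> = trunc c x * v + trunc c x * H x" by (rule distrib_left)
      also have "\<dots> \<le> osc c x * v + N * H x" by (intro add_mono mult_right_mono) auto
      finally show ?thesis using True by (simp add: mult.commute)
    qed simp
  qed
  also have "\<dots> = v * (\<integral>\<^sup>+x\<in>?R. osc c x \<partial>lebesgue) + N * (\<integral>\<^sup>+x\<in>?R. H x \<partial>lebesgue)"
    by (simp add: nn_integral_add nn_integral_cmult)
  also have "\<dots> \<le> v * (3 * emeasure lebesgue ?R) + N * (\<integral>\<^sup>+x\<in>?R. H x \<partial>lebesgue)"
    by (intro add_right_mono mult_left_mono osc3) simp
  also have "v * (3 * emeasure lebesgue ?R) = 3 * (v * emeasure lebesgue ?R)" by (simp only: mult_ac)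
  also have "3 * (v * emeasure lebesgue ?R) + N * (\<integral>\<^sup>+x\<in>?R. H x \<partial>lebesgue)
      \<le> 3 * ((\<integral>\<^sup>+x\<in>?R. W x \<partial>lebesgue) + (\<integral>\<^sup>+x\<in>?R. H x \<partial>lebesgue)) + N * (\<integral>\<^sup>+x\<in>?R. H x \<partial>lebesgue)"
    by (intro add_right_mono mult_left_mono vR) simp
  also have "\<dots> = 3 * (\<integral>\<^sup>+x\<in>?R. W x \<partial>lebesgue) + (N + 3) * (\<integral>\<^sup>+x\<in>?R. H x \<partial>lebesgue)"
    by (simp only: distrib_left distrib_right add_ac)
  also have "\<dots> \<le> A * (\<integral>\<^sup>+x\<in>?R. W x \<partial>lebesgue) + (N + 3) * (\<integral>\<^sup>+x\<in>?R. H x \<partial>lebesgue)"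
    by (intro add_right_mono mult_right_mono) (auto simp: A)
  finally show ?thesis unfolding controlled_def by simp
qed

text \<open>When \<open>c\<close> is the average of \<open>b\<close> over \<open>R\<close>, the stopping cubes fill at most half of \<open>R\<close>. On the other
  half \<open>G\<close> is at least the average of \<open>W\<close> over \<open>R\<close>, hence twice its integral there
  pays for \<open>W(R)\<close>. The coefficient of \<open>\<integral> G\<close> is thus the same on \<open>E\<close> and on \<open>R - E\<close>, and does
  not grow with the number of generations.\<close>

lemma controlled_absorb:
  assumes R: "R \<in> cubes" "R \<subseteq> Q" and E: "controlled R (average b R) E"
  shows "(\<integral>\<^sup>+x\<in>R. trunc (average b R) x * W x \<partial>lebesgue)
    \<le> 2 * A * (\<integral>\<^sup>+x\<in>R. G x \<partial>lebesgue) + (N + 3) * (\<integral>\<^sup>+x\<in>R. H x \<partial>lebesgue)"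
proof -
  let ?m = "emeasure lebesgue R" and ?W = "\<integral>\<^sup>+x\<in>R. W x \<partial>lebesgue"
  have [measurable]: "R \<in> sets lebesgue" "E \<in> sets lebesgue" and sub: "E \<subseteq> R"
    using R E by (auto simp: controlled_def)
  note m = emeasure_cubes(3,4)[OF R(1)]
  have "2 * emeasure lebesgue E \<le> (\<integral>\<^sup>+x\<in>R. osc (average b R) x \<partial>lebesgue)"
    using E by (simp add: controlled_def)
  also have "\<dots> \<le> ?m" by (rule osc_average_le[OF R(1)])
  finally have half: "2 * emeasure lebesgue E \<le> ?m" .
  have split: "?m = emeasure lebesgue E + emeasure lebesgue (R - E)"
    using sub by (subst plus_emeasure) (auto intro!: arg_cong2[where f = emeasure])
  have fin: "emeasure lebesgue E \<noteq> top" using m(2) split by (auto simp: ennreal_add_eq_top)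
  have "emeasure lebesgue E + emeasure lebesgue E \<le> emeasure lebesgue E + emeasure lebesgue (R - E)"
    using half split by (simp add: mult_2)
  then have "emeasure lebesgue E \<le> emeasure lebesgue (R - E)"
    using fin by (simp add: ennreal_add_left_cancel_le)
  then have big: "?m \<le> 2 * emeasure lebesgue (R - E)"
    unfolding split mult_2 by (rule add_right_mono)
  have "?m * ?W \<le> 2 * emeasure lebesgue (R - E) * ?W"
    by (rule mult_right_mono[OF big]) simp
  also have "\<dots> = 2 * (\<integral>\<^sup>+x. ?W * indicator (R - E) x \<partial>lebesgue)"
    by (subst nn_integral_cmult_indicator) (simp_all add: mult_ac)
  also have "\<dots> \<le> 2 * (\<integral>\<^sup>+x. ?m * (G x * indicator (R - E) x) \<partial>lebesgue)"
    using averages_le[OF R] by (intro mult_left_mono nn_integral_mono) (auto simp: mult.commute split: split_indicator)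
  also have "\<dots> = ?m * (2 * (\<integral>\<^sup>+x\<in>R - E. G x \<partial>lebesgue))"
    by (subst nn_integral_cmult) (simp_all add: mult.left_commute)
  finally have WG: "?W \<le> 2 * (\<integral>\<^sup>+x\<in>R - E. G x \<partial>lebesgue)"
    using m by (subst (asm) ennreal_mult_le_mult_iff) auto
  have GG: "(\<integral>\<^sup>+x\<in>R - E. G x \<partial>lebesgue) + (\<integral>\<^sup>+x\<in>E. G x \<partial>lebesgue) = (\<integral>\<^sup>+x\<in>R. G x \<partial>lebesgue)"
    using sub by (subst nn_integral_add[symmetric]) (auto intro!: nn_integral_cong split: split_indicator)
  have "(\<integral>\<^sup>+x\<in>R. trunc (average b R) x * W x \<partial>lebesgue)
      \<le> A * ?W + 2 * A * (\<integral>\<^sup>+x\<in>E. G x \<partial>lebesgue) + (N + 3) * (\<integral>\<^sup>+x\<in>R. H x \<partial>lebesgue)"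
    using E by (simp add: controlled_def)
  also have "\<dots> \<le> A * (2 * (\<integral>\<^sup>+x\<in>R - E. G x \<partial>lebesgue)) + 2 * A * (\<integral>\<^sup>+x\<in>E. G x \<partial>lebesgue)
      + (N + 3) * (\<integral>\<^sup>+x\<in>R. H x \<partial>lebesgue)"
    by (intro add_right_mono mult_left_mono WG) simp
  also have "A * (2 * (\<integral>\<^sup>+x\<in>R - E. G x \<partial>lebesgue)) + 2 * A * (\<integral>\<^sup>+x\<in>E. G x \<partial>lebesgue)
      = 2 * A * ((\<integral>\<^sup>+x\<in>R - E. G x \<partial>lebesgue) + (\<integral>\<^sup>+x\<in>E. G x \<partial>lebesgue))"
    by (simp only: distrib_left mult_ac)
  finally show ?thesis unfolding GG .
qed

text \<open>Induction on the number of generations down to scale \<open>\<delta>\<close>. In a subcube whose average is still within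
  2 of \<open>c\<close> the construction continues with the same \<open>c\<close>. Otherwise the subcube is a stopping cube: its
  average \<open>d\<close> satisfies \<open>|d - c| \<le> 2 + 2\<^sup>n\<close>, and relative to \<open>d\<close> the bound with the absorbed
  weight term is available from the previous generation.\<close>

lemma controlled_exists:
  assumes "0 < l" "l \<le> 2 ^ k * \<delta>" "cube a l \<subseteq> Q" "ennreal \<bar>average b (cube a l) - c\<bar> \<le> 2"
  shows "\<exists>E. controlled (cube a l) c E"
  using assms
proof (induction k arbitrary: a l c)
  case 0
  then show ?case by (intro exI[of _ "{}"] controlled_small) auto
next
  case (Suc k)
  have l: "l > 0" "l / 2 > 0" "l / 2 \<le> 2 ^ k * \<delta>" using Suc.prems by auto
  let ?R = "cube a l" and ?C = "child a l"
  have C: "?C s \<in> cubes" "?C s \<subseteq> Q" for s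
    using child_subset[OF l(1)] Suc.prems(3) l(2) unfolding child_def by (auto intro: cube_in_cubes)
  have "\<exists>E. controlled (?C s) c E" for s
  proof (cases "ennreal \<bar>average b (?C s) - c\<bar> \<le> 2")
    case True
    then show ?thesis
      using Suc.IH[OF l(2,3)] C(2) unfolding child_def by blast
  next
    case False
    let ?d = "average b (?C s)"
    have "\<exists>E. controlled (?C s) ?d E"
      using Suc.IH[OF l(2,3)] C(2)[of s] unfolding child_def by simp
    then obtain E where E: "controlled (?C s) ?d E" by blast
    note J = controlled_absorb[OF C E]
    \<comment> \<open>A stopping cube is charged to the oscillation of \<open>b\<close> on it.\<close>
    have "2 * emeasure lebesgue (?C s) \<le> ennreal \<bar>?d - c\<bar> * emeasure lebesgue (?C s)"
      by (rule mult_right_mono[OF less_imp_le]) (use False in \<open>simp_all only: not_le zero_le\<close>)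
    also have "\<dots> \<le> (\<integral>\<^sup>+x\<in>?C s. osc c x \<partial>lebesgue)"
      by (rule average_diff_le[OF b C(1)])
    finally have size: "2 * emeasure lebesgue (?C s) \<le> (\<integral>\<^sup>+x\<in>?C s. osc c x \<partial>lebesgue)" .
    have "ennreal \<bar>?d - c\<bar> \<le> ennreal \<bar>?d - average b ?R\<bar> + ennreal \<bar>average b ?R - c\<bar>"
      by (subst ennreal_plus[symmetric]) (auto intro!: ennreal_leI simp del: ennreal_plus)
    also have "\<dots> \<le> 2 ^ CARD('n) + 2"
      by (intro add_mono average_child_diff b bmo l Suc.prems)
    also have "\<dots> \<le> A" unfolding A by (subst add.commute) (intro add_right_mono, simp)
    finally have jump: "ennreal \<bar>?d - c\<bar> \<le> A" .
    have "(\<integral>\<^sup>+x\<in>?C s. trunc c x * W x \<partial>lebesgue)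
        \<le> (\<integral>\<^sup>+x. A * (W x * indicator (?C s) x) + trunc ?d x * W x * indicator (?C s) x \<partial>lebesgue)"
    proof (intro nn_integral_mono)
      fix x
      have "osc c x \<le> A + osc ?d x"
        using osc_triangle[of x c ?d] jump by (meson add_right_mono order.trans)
      then have "trunc c x \<le> A + trunc ?d x"
        by (auto simp: min_def intro: order.trans add_increasing)
      from mult_right_mono[OF this, of "W x"]
      show "trunc c x * W x * indicator (?C s) x
          \<le> A * (W x * indicator (?C s) x) + trunc ?d x * W x * indicator (?C s) x"
        by (simp add: distrib_right split: split_indicator)
    qed
    also have "\<dots> = A * (\<integral>\<^sup>+x\<in>?C s. W x \<partial>lebesgue) + (\<integral>\<^sup>+x\<in>?C s. trunc ?d x * W x \<partial>lebesgue)"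
      by (simp add: nn_integral_add nn_integral_cmult)
    also have "\<dots> \<le> A * (\<integral>\<^sup>+x\<in>?C s. W x \<partial>lebesgue) + (2 * A * (\<integral>\<^sup>+x\<in>?C s. G x \<partial>lebesgue)
         + (N + 3) * (\<integral>\<^sup>+x\<in>?C s. H x \<partial>lebesgue))"
      by (rule add_left_mono[OF J])
    finally have "controlled (?C s) c (?C s)"
      using size unfolding controlled_def by (simp add: add.assoc)
    then show ?thesis by blast
  qed
  then obtain E where E: "\<And>s. controlled (?C s) c (E s)" by metis
  then have [measurable]: "\<And>s. E s \<in> sets lebesgue" and sub: "\<And>s. E s \<subseteq> ?C s"
    unfolding controlled_def by auto
  have "2 * emeasure lebesgue (\<Union>s. E s) \<le> 2 * (\<Sum>s\<in>UNIV. emeasure lebesgue (E s))"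
    by (intro mult_left_mono emeasure_subadditive_finite) auto
  also have "\<dots> = (\<Sum>s\<in>UNIV. 2 * emeasure lebesgue (E s))" by (rule sum_distrib_left)
  also have "\<dots> \<le> (\<Sum>s\<in>UNIV. \<integral>\<^sup>+x\<in>?C s. osc c x \<partial>lebesgue)"
    using E by (intro sum_mono) (auto simp: controlled_def)
  also have "\<dots> = (\<integral>\<^sup>+x\<in>?R. osc c x \<partial>lebesgue)"
    by (rule nn_integral_children[OF l(1), symmetric]) measurable
  finally have size: "2 * emeasure lebesgue (\<Union>s. E s) \<le> (\<integral>\<^sup>+x\<in>?R. osc c x \<partial>lebesgue)" .
  have "(\<integral>\<^sup>+x\<in>?R. trunc c x * W x \<partial>lebesgue) = (\<Sum>s\<in>UNIV. \<integral>\<^sup>+x\<in>?C s. trunc c x * W x \<partial>lebesgue)"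
    by (rule nn_integral_children[OF l(1)]) measurable
  also have "\<dots> \<le> (\<Sum>s\<in>UNIV. A * (\<integral>\<^sup>+x\<in>?C s. W x \<partial>lebesgue) + 2 * A * (\<integral>\<^sup>+x\<in>E s. G x \<partial>lebesgue)
         + (N + 3) * (\<integral>\<^sup>+x\<in>?C s. H x \<partial>lebesgue))"
    using E by (intro sum_mono) (auto simp: controlled_def)
  also have "\<dots> = A * (\<Sum>s\<in>UNIV. \<integral>\<^sup>+x\<in>?C s. W x \<partial>lebesgue) + 2 * A * (\<Sum>s\<in>UNIV. \<integral>\<^sup>+x\<in>E s. G x \<partial>lebesgue)
         + (N + 3) * (\<Sum>s\<in>UNIV. \<integral>\<^sup>+x\<in>?C s. H x \<partial>lebesgue)"
    by (simp only: sum.distrib sum_distrib_left)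
  also have "\<dots> \<le> A * (\<integral>\<^sup>+x\<in>?R. W x \<partial>lebesgue) + 2 * A * (\<integral>\<^sup>+x\<in>(\<Union>s. E s). G x \<partial>lebesgue)
         + (N + 3) * (\<integral>\<^sup>+x\<in>?R. H x \<partial>lebesgue)"
    unfolding nn_integral_children[OF l(1) W] nn_integral_children[OF l(1) H]
    using sub by (intro add_mono mult_left_mono nn_integral_UN_children_ge[OF l(1)] order.refl) auto
  finally have "controlled ?R c (\<Union>s. E s)"
    using size unfolding controlled_def
    by (intro conjI sets.finite_UN UN_least order.trans[OF sub child_subset[OF l(1)]]) auto
  then show ?case by blast
qed

lemma truncated_oscillation_le:
  assumes "Q \<in> cubes"
  shows "(\<integral>\<^sup>+x\<in>Q. trunc (average b Q) x * W x \<partial>lebesgue)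
    \<le> 2 * A * (\<integral>\<^sup>+x\<in>Q. G x \<partial>lebesgue) + (N + 3) * (\<integral>\<^sup>+x\<in>Q. H x \<partial>lebesgue)"
proof -
  obtain a l where l: "l > 0" "Q = cube a l" using assms cubes_iff by blast
  obtain k where "l / \<delta> < 2 ^ k" using real_arch_pow[of 2 "l / \<delta>"] by auto
  then have "l \<le> 2 ^ k * \<delta>" using \<delta> by (simp add: field_simps)
  then have "\<exists>E. controlled Q (average b Q) E"
    unfolding l(2) using l by (intro controlled_exists) auto
  then show ?thesis using controlled_absorb assms by blast
qed

end

section \<open>The oscillation is controlled by the maximal integral\<close>

text \<open>A measurable function is an almost everywhere limit of continuous ones. For a bounded function these
  can be clamped to the same bounds, so they converge in \<open>L\<^sup>1(Q)\<close>; a continuous function close to \<open>u\<close>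
  is nearly constant on small subcubes of \<open>Q\<close>. This replaces the differentiation theorem in the
  passage to the limit.\<close>

lemma approx_constant_on_small_cubes:
  fixes u :: "real ^ 'n \<Rightarrow> real"
  assumes u [measurable]: "u \<in> borel_measurable lebesgue" and bd: "\<And>x. 0 \<le> u x" "\<And>x. u x \<le> B"
    and Q: "Q \<in> cubes" and \<eta>: "\<eta> > 0"
  obtains \<delta> and H :: "real ^ 'n \<Rightarrow> ennreal" where
    "\<delta> > 0" "H \<in> borel_measurable lebesgue" "(\<integral>\<^sup>+x\<in>Q. H x \<partial>lebesgue) \<le> ennreal \<eta>"
    "\<And>a l. 0 < l \<Longrightarrow> l \<le> \<delta> \<Longrightarrow> cube a l \<subseteq> Q \<Longrightarrow>
        \<exists>v. \<forall>x\<in>cube a l. ennreal (u x) \<le> v + H x \<and> v \<le> ennreal (u x) + H x"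
proof -
  have [measurable]: "Q \<in> sets lebesgue" using Q by simp
  define m where "m = measure lebesgue Q"
  have m: "m > 0" "emeasure lebesgue Q = ennreal m" unfolding m_def using emeasure_cubes[OF Q] by auto
  have B: "0 \<le> B" using bd order.trans by blast
  have "u measurable_on UNIV" by (rule lebesgue_measurable_imp_measurable_on) auto
  then obtain Z g where Z: "negligible Z" and gc: "\<And>n. continuous_on UNIV (g n)"
    and glim: "\<And>x. x \<notin> Z \<Longrightarrow> (\<lambda>n. g n x) \<longlonglongrightarrow> u x"
    unfolding measurable_on_def by auto
  define p where "p n x = min B (max 0 (g n x))" for n x
  have pc: "continuous_on UNIV (p n)" for n
    unfolding p_def by (intro continuous_intros gc)
  have pm [measurable]: "p n \<in> borel_measurable lebesgue" for n
    using borel_measurable_continuous_onI[OF pc] by (simp add: measurable_completion)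
  have p0: "0 \<le> p n x" for n x using B by (simp add: p_def)
  have plim: "(\<lambda>n. p n x) \<longlonglongrightarrow> u x" if "x \<notin> Z" for x
  proof -
    have "(\<lambda>n. p n x) \<longlonglongrightarrow> min B (max 0 (u x))"
      unfolding p_def by (intro tendsto_intros glim that)
    then show ?thesis by (simp add: bd min_absorb2 max_absorb2)
  qed
  have "AE x in lebesgue. x \<notin> Z" using Z by (intro AE_not_in) (simp only: negligible_iff_null_sets)
  then have ae: "AE x in lebesgue. (\<lambda>n. \<bar>u x - p n x\<bar> * indicator Q x) \<longlonglongrightarrow> 0"
  proof eventually_elim
    case (elim x)
    have "(\<lambda>n. \<bar>u x - p n x\<bar> * indicator Q x) \<longlonglongrightarrow> \<bar>u x - u x\<bar> * indicator Q x"
      by (intro tendsto_intros plim elim)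
    then show ?case by simp
  qed
  have dom: "norm (\<bar>u x - p n x\<bar> * indicator Q x) \<le> B * indicator Q x" for n x
    using bd[of x] p0[of n x] B by (auto simp: p_def abs_le_iff split: split_indicator)
  have int: "integrable lebesgue (\<lambda>x. B * indicator Q x)" using m by simp
  have intp: "integrable lebesgue (\<lambda>x. \<bar>u x - p n x\<bar> * indicator Q x)" for n
  proof (rule Bochner_Integration.integrable_bound[OF int])
    show "AE x in lebesgue. norm (\<bar>u x - p n x\<bar> * indicator Q x) \<le> norm (B * indicator Q x)"
      using B dom by (intro AE_I2) simp
  qed measurable
  have "(\<lambda>n. integral\<^sup>L lebesgue (\<lambda>x. \<bar>u x - p n x\<bar> * indicator Q x)) \<longlonglongrightarrow> integral\<^sup>L lebesgue (\<lambda>x::real^'n. 0::real)"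
    using ae dom int by (intro integral_dominated_convergence[where w = "\<lambda>x. B * indicator Q x"]) auto
  then have "\<forall>\<^sub>F n in sequentially. integral\<^sup>L lebesgue (\<lambda>x. \<bar>u x - p n x\<bar> * indicator Q x) < \<eta> / 2"
    by (rule order_tendstoD) (use \<eta> in simp)
  then obtain n where n: "integral\<^sup>L lebesgue (\<lambda>x. \<bar>u x - p n x\<bar> * indicator Q x) < \<eta> / 2"
    using eventually_sequentially by auto
  \<comment> \<open>Half of \<open>\<eta>\<close> goes to the distance in mean, half to the modulus of continuity.\<close>
  define \<epsilon> where "\<epsilon> = \<eta> / (2 * m)"
  have \<epsilon>: "\<epsilon> > 0" "\<epsilon> * m = \<eta> / 2" using \<eta> m by (auto simp: \<epsilon>_def)
  have "compact Q" using Q compact_cube cubes_iff by metis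
  then have "uniformly_continuous_on Q (p n)"
    by (intro compact_uniformly_continuous continuous_on_subset[OF pc]) auto
  then obtain d where d: "d > 0" "\<And>x y. x \<in> Q \<Longrightarrow> y \<in> Q \<Longrightarrow> dist y x < d \<Longrightarrow> dist (p n y) (p n x) < \<epsilon>"
    unfolding uniformly_continuous_on_def using \<epsilon>(1) by metis
  define H where "H x = ennreal (\<bar>u x - p n x\<bar> + \<epsilon>)" for x
  show thesis
  proof (rule that[of "d / (2 * CARD('n))" H])
    show "0 < d / (2 * CARD('n))" using d by simp
    show "H \<in> borel_measurable lebesgue" unfolding H_def by measurable
    have "(\<integral>\<^sup>+x\<in>Q. H x \<partial>lebesgue)
        = (\<integral>\<^sup>+x. ennreal (\<bar>u x - p n x\<bar> * indicator Q x) + ennreal \<epsilon> * indicator Q x \<partial>lebesgue)"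
      unfolding H_def using \<epsilon>(1) by (intro nn_integral_cong) (auto split: split_indicator)
    also have "\<dots> = ennreal (integral\<^sup>L lebesgue (\<lambda>x. \<bar>u x - p n x\<bar> * indicator Q x)) + ennreal \<epsilon> * emeasure lebesgue Q"
      using intp[of n] by (subst nn_integral_add) (auto simp: nn_integral_cmult_indicator nn_integral_eq_integral)
    also have "\<dots> \<le> ennreal (\<eta> / 2) + ennreal (\<eta> / 2)"
      using n \<epsilon> m by (intro add_mono) (auto simp: ennreal_mult'[symmetric] intro!: ennreal_leI)
    also have "\<dots> = ennreal \<eta>" using \<eta> by (subst ennreal_plus[symmetric]) (auto simp del: ennreal_plus)
    finally show "(\<integral>\<^sup>+x\<in>Q. H x \<partial>lebesgue) \<le> ennreal \<eta>" .
  next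
    fix a :: "real ^ 'n" and l :: real
    assume l: "0 < l" "l \<le> d / (2 * CARD('n))" and sub: "cube a l \<subseteq> Q"
    have aQ: "a \<in> cube a l" using l by (simp add: mem_cube)
    show "\<exists>v. \<forall>x\<in>cube a l. ennreal (u x) \<le> v + H x \<and> v \<le> ennreal (u x) + H x"
    proof (intro exI[of _ "ennreal (p n a)"] ballI)
      fix x assume x: "x \<in> cube a l"
      \<comment> \<open>The side is at most \<open>d / (2 n)\<close>, so the sum norm of \<open>x - a\<close> is below \<open>d\<close>.\<close>
      have "dist x a \<le> (\<Sum>i\<in>UNIV. \<bar>(x - a) $ i\<bar>)" unfolding dist_norm by (rule norm_le_l1_cart)
      also have "\<dots> \<le> (\<Sum>i\<in>(UNIV :: 'n set). l)"
      proof (rule sum_mono)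
        fix i show "\<bar>(x - a) $ i\<bar> \<le> l" using x[unfolded mem_cube, rule_format, of i] by simp
      qed
      also have "\<dots> \<le> d / 2" using l(2) by (simp add: field_simps)
      also have "\<dots> < d" using d(1) by simp
      finally have "dist (p n x) (p n a) < \<epsilon>" using d(2) aQ x sub by blast
      then have near: "\<bar>p n x - p n a\<bar> < \<epsilon>" by (simp add: dist_real_def)
      have "ennreal (u x) \<le> ennreal (p n a + (\<bar>u x - p n x\<bar> + \<epsilon>))"
        "ennreal (p n a) \<le> ennreal (u x + (\<bar>u x - p n x\<bar> + \<epsilon>))"
        using near by (intro ennreal_leI; linarith)+
      then show "ennreal (u x) \<le> ennreal (p n a) + H x \<and> ennreal (p n a) \<le> ennreal (u x) + H x"
        using p0[of n a] bd(1)[of x] \<epsilon>(1) unfolding H_def by simp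
    qed
  qed
qed

text \<open>The dyadic bound is applied to both factors truncated at level \<open>N\<close>. First the approximation error
  tends to 0 for fixed \<open>N\<close>, then \<open>N\<close> tends to infinity by monotone convergence.\<close>

lemma oscillation_le_maximal_integral:
  fixes w b :: "real ^ 'n \<Rightarrow> real"
  assumes w: "is_weight w" and b: "locally_integrable b" and bmo: "BMO_norm b \<le> 1" and Q: "Q \<in> cubes"
  shows "(\<integral>\<^sup>+x\<in>Q. ennreal (\<bar>b x - average b Q\<bar> * w x) \<partial>lebesgue)
    \<le> 2 * (3 + 2 ^ CARD('n)) * (\<integral>\<^sup>+x\<in>Q. maximal (\<lambda>y. w y * indicator Q y) x \<partial>lebesgue)"
proof -
  have [measurable]: "w \<in> borel_measurable lebesgue" "b \<in> borel_measurable lebesgue" "Q \<in> sets lebesgue"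
    using weight_measurable[OF w] locally_integrable_measurable[OF b] Q by auto
  have w0: "0 \<le> w x" for x using w by (simp add: is_weight_def)
  let ?G = "maximal (\<lambda>y. w y * indicator Q y)"
  let ?bound = "2 * (3 + 2 ^ CARD('n)) * (\<integral>\<^sup>+x\<in>Q. ?G x \<partial>lebesgue)"
  define F where "F N x = min (ennreal \<bar>b x - average b Q\<bar>) (ennreal (real N)) * ennreal (min (w x) (real N)) * indicator Q x"
    for N x
  have [measurable]: "F N \<in> borel_measurable lebesgue" for N unfolding F_def by measurable
  have "integral\<^sup>N lebesgue (F N) \<le> ?bound" for N
  proof (rule ennreal_le_epsilon)
    fix e :: real assume e: "e > 0"
    define \<eta> where "\<eta> = e / (real N + 3)"
    have \<eta>: "\<eta> > 0" "(real N + 3) * \<eta> = e" using e by (auto simp: \<eta>_def)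
    have um: "(\<lambda>x. min (w x) (real N)) \<in> borel_measurable lebesgue" by measurable
    obtain \<delta> H where h: "\<delta> > 0" "H \<in> borel_measurable lebesgue" "(\<integral>\<^sup>+x\<in>Q. H x \<partial>lebesgue) \<le> ennreal \<eta>"
      "\<And>a l. 0 < l \<Longrightarrow> l \<le> \<delta> \<Longrightarrow> cube a l \<subseteq> Q \<Longrightarrow>
        \<exists>v. \<forall>x\<in>cube a l. ennreal (min (w x) (real N)) \<le> v + H x \<and> v \<le> ennreal (min (w x) (real N)) + H x"
      by (rule approx_constant_on_small_cubes[OF um _ _ Q \<eta>(1), of "real N"]) (use w0 in auto)
    interpret dyadic_domination b "\<lambda>x. ennreal (min (w x) (real N))" ?G H Q "ennreal (real N)" "3 + 2 ^ CARD('n)" \<delta>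
    proof
      fix R x assume R: "R \<in> cubes" "R \<subseteq> Q" "x \<in> R"
      have "(\<integral>\<^sup>+y\<in>R. ennreal (min (w y) (real N)) \<partial>lebesgue) \<le> (\<integral>\<^sup>+y\<in>R. ennreal \<bar>w y * indicator Q y\<bar> \<partial>lebesgue)"
        using R(2) w0 by (intro nn_integral_mono) (auto split: split_indicator intro!: ennreal_leI)
      also have "\<dots> \<le> ?G x * emeasure lebesgue R" using R by (intro average_le_maximal)
      finally show "(\<integral>\<^sup>+y\<in>R. ennreal (min (w y) (real N)) \<partial>lebesgue) \<le> ?G x * emeasure lebesgue R" .
    qed (use b bmo h in auto)
    have "integral\<^sup>N lebesgue (F N) \<le> ?bound + (ennreal (real N) + 3) * (\<integral>\<^sup>+x\<in>Q. H x \<partial>lebesgue)"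
      unfolding F_def by (rule truncated_oscillation_le[OF Q])
    also have "\<dots> \<le> ?bound + (ennreal (real N) + 3) * ennreal \<eta>"
      by (intro add_left_mono mult_left_mono h(3)) simp
    also have "(ennreal (real N) + 3) * ennreal \<eta> = ennreal e"
    proof -
      have "ennreal (real N) + 3 = ennreal (real N + 3)" by simp
      then show ?thesis using \<eta> by (simp only: ennreal_mult'[symmetric] of_nat_0_le_iff add_nonneg_nonneg zero_le_numeral)
    qed
    finally show "integral\<^sup>N lebesgue (F N) \<le> ?bound + ennreal e" .
  qed
  moreover have "(\<integral>\<^sup>+x\<in>Q. ennreal (\<bar>b x - average b Q\<bar> * w x) \<partial>lebesgue) \<le> (SUP N. integral\<^sup>N lebesgue (F N))"
  proof -
    have "incseq F"
      unfolding F_def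
      by (intro incseq_SucI le_funI mult_right_mono mult_mono min.mono ennreal_leI order.refl) auto
    then have "(SUP N. integral\<^sup>N lebesgue (F N)) = (\<integral>\<^sup>+x. (SUP N. F N x) \<partial>lebesgue)"
      by (intro nn_integral_monotone_convergence_SUP[symmetric]) auto
    moreover have "ennreal (\<bar>b x - average b Q\<bar> * w x) * indicator Q x \<le> (SUP N. F N x)" for x
    proof -
      obtain N where N: "max \<bar>b x - average b Q\<bar> (w x) \<le> real N" using real_arch_simple by blast
      then have "ennreal \<bar>b x - average b Q\<bar> \<le> ennreal (real N)" "min (w x) (real N) = w x"
        by (auto intro!: ennreal_leI)
      then have "F N x = ennreal (\<bar>b x - average b Q\<bar> * w x) * indicator Q x"
        unfolding F_def using w0 by (simp only: min_absorb1 ennreal_mult abs_ge_zero)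
      then show ?thesis by (metis SUP_upper UNIV_I)
    qed
    ultimately show ?thesis by (simp add: nn_integral_mono)
  qed
  ultimately show ?thesis by (meson SUP_least order.trans)
qed

lemma weighted_oscillation_le_A_infinity:
  fixes w :: "real ^ 'n \<Rightarrow> real"
  assumes w: "is_weight w"
  shows "weighted_oscillation w \<le> 2 * (3 + 2 ^ CARD('n)) * A_infinity w"
  unfolding weighted_oscillation_def
proof (intro SUP_least)
  fix b :: "real ^ 'n \<Rightarrow> real" and Q :: "(real ^ 'n) set"
  assume "b \<in> {b. locally_integrable b \<and> BMO_norm b = 1}" and Q: "Q \<in> {Q \<in> cubes. weight_of w Q > 0}"
  then have b: "locally_integrable b" "BMO_norm b \<le> 1" by auto
  let ?W = "weight_of w Q"
  have "(\<integral>\<^sup>+x\<in>Q. ennreal (\<bar>b x - average b Q\<bar> * w x) \<partial>lebesgue) / ?W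
    \<le> 2 * (3 + 2 ^ CARD('n)) * (\<integral>\<^sup>+x\<in>Q. maximal (\<lambda>y. w y * indicator Q y) x \<partial>lebesgue) / ?W"
    using Q by (intro divide_right_mono_ennreal oscillation_le_maximal_integral w b) auto
  also have "\<dots> = 2 * (3 + 2 ^ CARD('n)) * ((\<integral>\<^sup>+x\<in>Q. maximal (\<lambda>y. w y * indicator Q y) x \<partial>lebesgue) / ?W)"
    by (rule ennreal_times_divide[symmetric])
  also have "\<dots> \<le> 2 * (3 + 2 ^ CARD('n)) * A_infinity w"
    unfolding A_infinity_def using Q by (intro mult_left_mono SUP_upper) auto
  finally show "(\<integral>\<^sup>+x\<in>Q. ennreal (\<bar>b x - average b Q\<bar> * w x) \<partial>lebesgue) / ?W
    \<le> 2 * (3 + 2 ^ CARD('n)) * A_infinity w" .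
qed

section \<open>Equivalence of the two constants\<close>

theorem corollary2p1:
  shows "\<exists>C::real. C > 0 \<and>
    (\<forall>w :: real ^ 'n \<Rightarrow> real. is_weight w \<longrightarrow>
       A_infinity w \<le> ennreal C * weighted_oscillation w \<and>
       weighted_oscillation w \<le> ennreal C * A_infinity w)"
proof -
  define C1 C2 :: real
    where "C1 = 2 ^ CARD('n) + 2 * 3 ^ CARD('n) * (4 * 9 ^ CARD('n) + 2 * 3 ^ CARD('n) * 2 ^ CARD('n))"
      and "C2 = 2 * (3 + 2 ^ CARD('n))"
  have pos: "C1 > 0" "C2 > 0" unfolding C1_def C2_def by (auto intro!: add_pos_pos mult_pos_pos)
  have C1: "ennreal C1 = 2 ^ CARD('n) + 2 * 3 ^ CARD('n) * (4 * 9 ^ CARD('n) + 2 * 3 ^ CARD('n) * 2 ^ CARD('n))"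
    and C2: "ennreal C2 = 2 * (3 + 2 ^ CARD('n))"
    unfolding C1_def C2_def by (simp_all add: ennreal_mult' ennreal_power[symmetric] del: ennreal_power)
  have "A_infinity w \<le> ennreal (C1 + C2) * weighted_oscillation w \<and>
       weighted_oscillation w \<le> ennreal (C1 + C2) * A_infinity w" if w: "is_weight w" for w :: "real ^ 'n \<Rightarrow> real"
  proof
    have "A_infinity w \<le> ennreal C1 * weighted_oscillation w"
      unfolding C1 by (rule A_infinity_le_weighted_oscillation[OF w])
    also have "\<dots> \<le> ennreal (C1 + C2) * weighted_oscillation w"
      using pos by (intro mult_right_mono ennreal_leI) auto
    finally show "A_infinity w \<le> ennreal (C1 + C2) * weighted_oscillation w" .
    have "weighted_oscillation w \<le> ennreal C2 * A_infinity w"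
      unfolding C2 by (rule weighted_oscillation_le_A_infinity[OF w])
    also have "\<dots> \<le> ennreal (C1 + C2) * A_infinity w"
      using pos by (intro mult_right_mono ennreal_leI) auto
    finally show "weighted_oscillation w \<le> ennreal (C1 + C2) * A_infinity w" .
  qed
  with pos show ?thesis by (intro exI[of _ "C1 + C2"]) auto
qed

end
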